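(* Let $(X_i,Y_i)$, $i\ge 1$, be i.i.d. copies of $(X,Y)$ with $Y=\beta_0^TX+\epsilon$, and suppose that assumptions (A1)-(A8) listed in the context hold. Let $(\widehat\beta_n,\widehat s_n)$ denote a maximum likelihood estimator of $(\beta_0,s_0)$ based on $(X_1,Y_1),\dots,(X_n,Y_n)$, that is, any maximizer over $\mathbb R^d\times(0,\infty)$ of $$\ell_n(\beta,s)=-n\log s+\sum_{i=1}^n\log f\left(\frac{Y_i-\beta^TX_i}{s}\right).$$ Then, as $n\to\infty$, $$(\widehat\beta_n,\widehat s_n)\to(\beta_0,s_0)\quad\text{in probability.}$$
   Context: Setting: $d\ge1$ is an integer, $\beta_0\in\mathbb R^d$ and $s_0\in(0,\infty)$ are the true (unknown) regression vector and scale, and $\mathbb E_{(\beta_0,s_0)}$ denotes expectation under the true distribution of $(X,Y)$. Convention: $\log 0=-\infty$. $\|\cdot\|$ is the Euclidean norm. Assumptions: (A1) $X$ and $\epsilon$ are independent. (A2) The distribution of $X$ admits a density $f^X$ with respect to Lebesgue measure on $\mathbb R^d$. (A3) The distribution of $\epsilon$ admits the density $f^\epsilon(t)=s_0^{-1}f(t/s_0)$, where $f$ is a known even, bounded and continuous probability density on $\mathbb R$ with $\int_{\mathbb R}t^2f(t)\,dt<\infty$. (A4) There exist $\alpha>0$ and $C>0$ such that $f(t)\le C\exp(-|t|^\alpha)$ for all $t$. (A5) $\mathbb E_{(\beta_0,s_0)}\left|\log f\left(\frac{Y-\beta_0^TX}{s_0}\right)\right|<\infty$. (A6) $\mathbb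 E[\|X\|^{\max(2\alpha,2)}]<\infty$, with $\alpha$ as in (A4). (A7) $f$ is non-increasing on $[0,\infty)$. (A8) $\mathbb E_{(\beta_0,s_0)}\left[\left(\log f\left(\frac{|Y|+R\|X\|}{a}\right)\right)^2\right]<\infty$ for any $R>0$, $a>0$. (Under these assumptions a maximizer of $\ell_n$ exists almost surely for all $n$ large enough; it need not be unique.) *)

theory Defs
  imports "HOL-Probability.Probability"
begin

(* Only applied to values of a nonnegative function; realises log 0 = -infinity. *)
definition log0 :: "real \<Rightarrow> ereal" where
  "log0 t = (if 0 < t then ereal (ln t) else -\<infinity>)"

(* No summand is +infinity, so extended-real addition is unproblematic here. *)
definition loglik ::
    "(real \<Rightarrow> real) \<Rightarrow> nat \<Rightarrow> (nat \<Rightarrow> real ^ 'd) \<Rightarrow> (nat \<Rightarrow> real) \<Rightarrow> real ^ 'd \<Rightarrow> real \<Rightarrow> ereal" where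
  "loglik f n x y \<beta> s =
     ereal (- (real n * ln s)) + (\<Sum>i<n. log0 (f ((y i - \<beta> \<bullet> x i) / s)))"

definition is_mle ::
    "(real \<Rightarrow> real) \<Rightarrow> nat \<Rightarrow> (nat \<Rightarrow> real ^ 'd) \<Rightarrow> (nat \<Rightarrow> real) \<Rightarrow> real ^ 'd \<Rightarrow> real \<Rightarrow> bool" where
  "is_mle f n x y b t \<longleftrightarrow>
     0 < t \<and> (\<forall>\<beta> s. 0 < s \<longrightarrow> loglik f n x y \<beta> s \<le> loglik f n x y b t)"

(* An arbitrary selection of maximizers need not be measurable, so the deviation
   probabilities are outer probabilities.  For random variables this is ordinary
   convergence in probability, as the lemma below shows. *)
definition converges_in_prob ::
    "'w measure \<Rightarrow> (nat \<Rightarrow> 'w \<Rightarrow> 'a :: metric_space) \<Rightarrow> 'a \<Rightarrow> bool" where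
  "converges_in_prob M Z z \<longleftrightarrow>
     (\<forall>e>0. (\<lambda>n. outer_measure_of M {\<omega> \<in> space M. e < dist (Z n \<omega>) z}) \<longlonglongrightarrow> 0)"

lemma converges_in_prob_measurable:
  fixes Z :: "nat \<Rightarrow> 'w \<Rightarrow> 'a :: {metric_space, second_countable_topology}"
  assumes "prob_space M" and Z: "\<And>n. Z n \<in> borel_measurable M"
  shows "converges_in_prob M Z z \<longleftrightarrow>
     (\<forall>e>0. (\<lambda>n. measure M {\<omega> \<in> space M. e < dist (Z n \<omega>) z}) \<longlonglongrightarrow> 0)"
proof -
  interpret prob_space M by fact
  have "{\<omega> \<in> space M. e < dist (Z n \<omega>) z} \<in> sets M" for e n
    using Z[of n] by measurable
  then have "outer_measure_of M {\<omega> \<in> space M. e < dist (Z n \<omega>) z} =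
      ennreal (measure M {\<omega> \<in> space M. e < dist (Z n \<omega>) z})" for e n
    by (simp add: emeasure_eq_measure)
  moreover have "(\<lambda>n. ennreal (g n)) \<longlonglongrightarrow> 0 \<longleftrightarrow> g \<longlonglongrightarrow> 0" if "\<And>n. 0 \<le> g n" for g
    using tendsto_ennreal_iff[of g sequentially 0] that by simp
  ultimately show ?thesis
    unfolding converges_in_prob_def by simp
qed

end

theory Submission
  imports Defs "HOL-Real_Asymp.Real_Asymp"
begin

text \<open>Wald's consistency argument. Assumption (A8) makes \<open>f\<close> positive everywhere and provides
  square-integrable envelopes for the log density, so Chebyshev's inequality supplies every law of
  large numbers that is needed.

  Coercivity: since \<open>(X, Y)\<close> charges no hyperplane through the origin, compactness of the unit
  sphere gives \<open>\<delta> > 0\<close> such that, with high probability and simultaneously for all \<open>\<beta>\<close>, at least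
  half of the residuals satisfy \<open>\<bar>Y\<^sub>i - \<beta> \<bullet> X\<^sub>i\<bar> \<ge> \<delta> \<parallel>(-\<beta>, 1)\<parallel>\<close>. By (A4) the average log
  likelihood is then at most \<open>log C - log s - (\<delta> \<parallel>(-\<beta>, 1)\<parallel> / s)\<^sup>\<alpha> / 2\<close>, which is as negative as
  desired outside a compact set of parameters with \<open>s > 0\<close>.

  On the compact set, the expected log density is strictly maximal at the true parameter (an
  equality case would give \<open>f\<close> a period, contradicting its decay), and this strict inequality
  persists for a local upper bound on small balls. Finitely many balls suffice.\<close>

section \<open>Events of asymptotically full outer probability\<close>

text \<open>Outer measure is used because events that quantify over uncountably many parameters, or
  that mention an arbitrary choice of maximizers, need not be measurable.\<close>

definition whp :: "'w measure \<Rightarrow> (nat \<Rightarrow> 'w \<Rightarrow> bool) \<Rightarrow> bool" where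
  "whp M A \<longleftrightarrow> (\<lambda>n. outer_measure_of M {\<omega> \<in> space M. \<not> A n \<omega>}) \<longlonglongrightarrow> 0"

lemma whp_mono:
  assumes "whp M A" and "\<forall>\<^sub>F n in sequentially. \<forall>\<omega>\<in>space M. A n \<omega> \<longrightarrow> B n \<omega>"
  shows "whp M B"
  unfolding whp_def
proof (rule tendsto_sandwich[OF _ _ tendsto_const assms(1)[unfolded whp_def]])
  show "\<forall>\<^sub>F n in sequentially. outer_measure_of M {\<omega> \<in> space M. \<not> B n \<omega>}
      \<le> outer_measure_of M {\<omega> \<in> space M. \<not> A n \<omega>}"
    using assms(2) by eventually_elim (intro outer_measure_of_mono, auto)
qed simp

text \<open>Measurable hulls attaining the two outer measures reduce this to subadditivity of the
  measure itself.\<close>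

lemma outer_measure_of_Un_le:
  assumes "A \<subseteq> space M" "B \<subseteq> space M"
  shows "outer_measure_of M (A \<union> B) \<le> outer_measure_of M A + outer_measure_of M B"
proof -
  obtain E where E: "E \<in> sets M" "A \<subseteq> E" "outer_measure_of M A = emeasure M E"
    using outer_measure_of_attain[OF assms(1)] by blast
  obtain F where F: "F \<in> sets M" "B \<subseteq> F" "outer_measure_of M B = emeasure M F"
    using outer_measure_of_attain[OF assms(2)] by blast
  have "outer_measure_of M (A \<union> B) \<le> outer_measure_of M (E \<union> F)"
    using E F by (intro outer_measure_of_mono) auto
  also have "\<dots> = emeasure M (E \<union> F)"
    using E F by simp
  also have "\<dots> \<le> emeasure M E + emeasure M F"
    using E F by (intro emeasure_subadditive)
  finally show ?thesis
    using E F by simp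
qed

lemma whp_conj:
  assumes "whp M A" "whp M B"
  shows "whp M (\<lambda>n \<omega>. A n \<omega> \<and> B n \<omega>)"
  unfolding whp_def
proof (rule tendsto_sandwich[OF _ _ tendsto_const])
  show "\<forall>\<^sub>F n in sequentially. outer_measure_of M {\<omega> \<in> space M. \<not> (A n \<omega> \<and> B n \<omega>)}
     \<le> outer_measure_of M {\<omega> \<in> space M. \<not> A n \<omega>} + outer_measure_of M {\<omega> \<in> space M. \<not> B n \<omega>}"
  proof (intro always_eventually allI)
    fix n
    have "{\<omega> \<in> space M. \<not> (A n \<omega> \<and> B n \<omega>)} =
        {\<omega> \<in> space M. \<not> A n \<omega>} \<union> {\<omega> \<in> space M. \<not> B n \<omega>}" by auto
    then show "outer_measure_of M {\<omega> \<in> space M. \<not> (A n \<omega> \<and> B n \<omega>)}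
     \<le> outer_measure_of M {\<omega> \<in> space M. \<not> A n \<omega>} + outer_measure_of M {\<omega> \<in> space M. \<not> B n \<omega>}"
      using outer_measure_of_Un_le[of "{\<omega> \<in> space M. \<not> A n \<omega>}" M "{\<omega> \<in> space M. \<not> B n \<omega>}"] by auto
  qed
  show "(\<lambda>n. outer_measure_of M {\<omega> \<in> space M. \<not> A n \<omega>}
      + outer_measure_of M {\<omega> \<in> space M. \<not> B n \<omega>}) \<longlonglongrightarrow> 0"
    using tendsto_add[OF assms[unfolded whp_def]] by simp
qed simp

lemma whp_ball:
  assumes "finite I" "\<And>i. i \<in> I \<Longrightarrow> whp M (A i)"
  shows "whp M (\<lambda>n \<omega>. \<forall>i\<in>I. A i n \<omega>)"
  using assms
proof (induction I rule: finite_induct)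
  case empty
  have "outer_measure_of M {} = 0" by simp
  then show ?case by (simp add: whp_def)
next
  case (insert i I)
  then show ?case using whp_conj[of M "A i" "\<lambda>n \<omega>. \<forall>i\<in>I. A i n \<omega>"] by simp
qed

lemma whp_AE:
  assumes "\<forall>\<^sub>F n in sequentially. AE \<omega> in M. A n \<omega>"
  shows "whp M A"
  unfolding whp_def
proof (rule tendsto_eventually, use assms in eventually_elim)
  fix n assume "AE \<omega> in M. A n \<omega>"
  then obtain N where N: "N \<in> null_sets M" "\<And>\<omega>. \<omega> \<in> space M - N \<Longrightarrow> A n \<omega>"
    by (auto elim: AE_E3)
  then have "outer_measure_of M {\<omega> \<in> space M. \<not> A n \<omega>} \<le> outer_measure_of M N"
    by (intro outer_measure_of_mono) auto
  also have "\<dots> = 0" using N(1) by (simp add: null_setsD1 null_setsD2)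
  finally show "outer_measure_of M {\<omega> \<in> space M. \<not> A n \<omega>} = 0" by simp
qed

section \<open>Weak law of large numbers under a second moment\<close>

context prob_space
begin

text \<open>The new summand is centred and independent of the partial sum, so the cross term in the
  induction step has expectation zero.\<close>

lemma second_moment_sum_indep:
  fixes W :: "nat \<Rightarrow> 'a \<Rightarrow> real"
  assumes indep: "indep_vars (\<lambda>_. borel) W UNIV"
    and sq: "\<And>i. integrable M (\<lambda>\<omega>. (W i \<omega>)\<^sup>2)"
    and mean: "\<And>i. expectation (W i) = 0"
    and var: "\<And>i. expectation (\<lambda>\<omega>. (W i \<omega>)\<^sup>2) = v"
  shows "integrable M (\<lambda>\<omega>. (\<Sum>i<n. W i \<omega>)\<^sup>2) \<and> expectation (\<lambda>\<omega>. (\<Sum>i<n. W i \<omega>)\<^sup>2) = n * v"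
proof (induction n)
  case (Suc n)
  let ?S = "\<lambda>\<omega>. \<Sum>i<n. W i \<omega>"
  have [measurable]: "random_variable borel (W i)" for i
    using indep by (auto simp: indep_vars_def)
  have int: "integrable M (W i)" for i
    by (rule square_integrable_imp_integrable[OF _ sq]) simp
  have ind: "indep_var borel (W n) borel ?S"
    by (rule indep_vars_sum[of "{..<n}" n W]) (auto intro: indep_vars_subset[OF indep])
  have intS: "integrable M ?S" using int by simp
  have "expectation ?S = 0" using mean int by (simp add: Bochner_Integration.integral_sum)
  then have cross: "integrable M (\<lambda>\<omega>. W n \<omega> * ?S \<omega>)" "expectation (\<lambda>\<omega>. W n \<omega> * ?S \<omega>) = 0"
    using indep_var_integrable[OF ind int intS] indep_var_lebesgue_integral[OF ind int intS] by auto
  have eq: "(\<Sum>i<Suc n. W i \<omega>)\<^sup>2 = (?S \<omega>)\<^sup>2 + 2 * (W n \<omega> * ?S \<omega>) + (W n \<omega>)\<^sup>2" for \<omega>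
    by (simp add: power2_sum algebra_simps)
  show ?case
    unfolding eq using Suc cross sq var by (simp add: algebra_simps)
qed simp

text \<open>Chebyshev's inequality: the variance of the sum grows like \<open>n\<close>, the squared
  deviation like the square of \<open>n\<close>. Sums are compared instead of averages, which avoids
  dividing by \<open>n\<close>.\<close>

lemma weak_law_of_large_numbers:
  fixes Z :: "nat \<Rightarrow> 'a \<Rightarrow> 'b :: topological_space" and h :: "'b \<Rightarrow> real" and e :: real
  assumes indep: "indep_vars (\<lambda>_. borel) Z UNIV"
    and law: "\<And>i. distr M borel (Z i) = Q"
    and h[measurable]: "h \<in> borel_measurable borel"
    and sq: "integrable Q (\<lambda>z. (h z)\<^sup>2)"
    and "0 < e"
  shows "whp M (\<lambda>n \<omega>. \<bar>(\<Sum>i<n. h (Z i \<omega>)) - n * (\<integral>z. h z \<partial>Q)\<bar> < n * e)"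
proof -
  have Z[measurable]: "random_variable borel (Z i)" for i
    using indep by (auto simp: indep_vars_def)
  have sqZ: "integrable M (\<lambda>\<omega>. (h (Z i \<omega>))\<^sup>2)" for i
    using sq integrable_distr_eq[OF Z[of i], of "\<lambda>z. (h z)\<^sup>2"] by (simp add: law)
  have intZ: "integrable M (\<lambda>\<omega>. h (Z i \<omega>))" for i
    by (rule square_integrable_imp_integrable[OF _ sqZ]) simp
  define \<mu> where "\<mu> = (\<integral>z. h z \<partial>Q)"
  define v where "v = (\<integral>z. (h z - \<mu>)\<^sup>2 \<partial>Q)"
  define W where "W i \<omega> = h (Z i \<omega>) - \<mu>" for i \<omega>
  have W_meas[measurable]: "random_variable borel (W i)" for i
    unfolding W_def by measurable
  have indepW: "indep_vars (\<lambda>_. borel) W UNIV"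
    unfolding W_def using indep_vars_compose2[OF indep, of "\<lambda>_ z. h z - \<mu>" "\<lambda>_. borel"] by simp
  have sqW: "integrable M (\<lambda>\<omega>. (W i \<omega>)\<^sup>2)" for i
    unfolding W_def power2_diff using sqZ intZ by auto
  have EZ: "expectation (\<lambda>\<omega>. h (Z i \<omega>)) = \<mu>" for i
    using integral_distr[OF Z[of i] h] by (simp add: law \<mu>_def)
  have EW: "expectation (W i) = 0" for i
    unfolding W_def using EZ intZ prob_space by simp
  have VW: "expectation (\<lambda>\<omega>. (W i \<omega>)\<^sup>2) = v" for i
    using integral_distr[OF Z[of i], of "\<lambda>z. (h z - \<mu>)\<^sup>2"] by (simp add: law v_def W_def)
  let ?S = "\<lambda>n \<omega>. \<Sum>i<n. W i \<omega>"
  note S = second_moment_sum_indep[OF indepW sqW EW VW]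
  have S_eq: "?S n \<omega> = (\<Sum>i<n. h (Z i \<omega>)) - n * \<mu>" for n \<omega>
    by (simp add: W_def sum_subtractf)
  have bound: "prob {\<omega> \<in> space M. n * e \<le> \<bar>?S n \<omega>\<bar>} \<le> v / e\<^sup>2 * (1 / n)" if "0 < n" for n :: nat
  proof -
    \<comment> \<open>Squaring turns the deviation event into one for Markov's inequality.\<close>
    have "{\<omega> \<in> space M. n * e \<le> \<bar>?S n \<omega>\<bar>} = {\<omega> \<in> space M. (n * e)\<^sup>2 \<le> (?S n \<omega>)\<^sup>2}"
      using \<open>0 < e\<close> by (auto simp: abs_le_square_iff[symmetric] zero_le_mult_iff)
    also have "prob \<dots> \<le> expectation (\<lambda>\<omega>. (?S n \<omega>)\<^sup>2) / (n * e)\<^sup>2"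
      using \<open>0 < e\<close> that S[of n] by (intro integral_Markov_inequality_measure[where A="{}"]) auto
    also have "\<dots> = v / e\<^sup>2 * (1 / n)"
      using S[of n] that by (simp add: power2_eq_square)
    finally show ?thesis .
  qed
  have "(\<lambda>n. prob {\<omega> \<in> space M. n * e \<le> \<bar>?S n \<omega>\<bar>}) \<longlonglongrightarrow> 0"
  proof (rule tendsto_sandwich[OF _ _ tendsto_const])
    show "\<forall>\<^sub>F n in sequentially. prob {\<omega> \<in> space M. n * e \<le> \<bar>?S n \<omega>\<bar>} \<le> v / e\<^sup>2 * (1 / n)"
      using eventually_gt_at_top[of "0::nat"] by eventually_elim (rule bound)
    show "(\<lambda>n. v / e\<^sup>2 * (1 / real n)) \<longlonglongrightarrow> 0"
      using tendsto_mult[OF tendsto_const lim_1_over_n, of "v / e\<^sup>2"] by simp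
  qed simp
  then have "(\<lambda>n. emeasure M {\<omega> \<in> space M. n * e \<le> \<bar>?S n \<omega>\<bar>}) \<longlonglongrightarrow> 0"
    unfolding emeasure_eq_measure by (simp flip: ennreal_0 add: tendsto_ennreal_iff)
  moreover have "{\<omega> \<in> space M. n * e \<le> \<bar>?S n \<omega>\<bar>} \<in> sets M" for n
    by measurable
  ultimately show ?thesis
    unfolding whp_def not_less S_eq \<mu>_def[symmetric] by simp
qed

end

section \<open>Uniform separation of the sample from hyperplanes\<close>

text \<open>Continuity from above gives a thin slab around a single null hyperplane small mass.
  Compactness of the unit sphere then leaves finitely many sets to control and one common width
  \<open>\<delta>\<close>.\<close>

lemma compact_sphere_cover_hyperplanes:
  fixes Q :: "'b :: euclidean_space measure"
  assumes "prob_space Q" and sets[measurable_cong]: "sets Q = sets borel"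
    and null: "\<And>v. v \<noteq> 0 \<Longrightarrow> measure Q {z. v \<bullet> z = 0} = 0"
  obtains \<delta> and T :: "'b set" and A :: "'b \<Rightarrow> 'b set" where "0 < \<delta>" "finite T"
    "\<forall>t\<in>T. A t \<in> sets borel \<and> measure Q (A t) < 1/2"
    "\<forall>v. norm v = 1 \<longrightarrow> (\<exists>t\<in>T. \<forall>z. \<bar>v \<bullet> z\<bar> < \<delta> \<longrightarrow> z \<in> A t)"
proof -
  interpret prob_space Q by fact
  \<comment> \<open>A slab alone is not stable under tilting \<open>v\<close>, since a tilt moves
    distant points far. The added exterior of a ball absorbs those points, and it vanishes in the
    limit of large \<open>k\<close>.\<close>
  define B where "B v k = {z :: 'b. \<bar>v \<bullet> z\<bar> \<le> 1 / Suc k} \<union> {z. real k < norm z}" for v k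
  have B_meas: "B v k \<in> sets borel" for v k
    unfolding B_def by measurable
  have "\<exists>k. prob (B v k) < 1/2" if "v \<noteq> 0" for v
  proof -
    have dec: "decseq (B v)"
    proof (rule decseq_SucI, rule subsetI)
      fix k z assume "z \<in> B v (Suc k)"
      moreover have "1 / real (Suc (Suc k)) \<le> 1 / real (Suc k)" by (simp add: frac_le)
      ultimately show "z \<in> B v k" unfolding B_def by auto
    qed
    have "(\<Inter>k. B v k) = {z. v \<bullet> z = 0}"
    proof (intro equalityI subsetI)
      fix z assume z: "z \<in> (\<Inter>k. B v k)"
      obtain k0 :: nat where k0: "norm z \<le> k0" using real_arch_simple by blast
      have "\<bar>v \<bullet> z\<bar> \<le> 1 / Suc k" if "k0 \<le> k" for k
      proof -
        have "norm z \<le> k" using k0 that by linarith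
        then show ?thesis using z unfolding B_def by force
      qed
      then have "\<bar>v \<bullet> z\<bar> \<le> 0"
        by (intro LIMSEQ_le_const[OF LIMSEQ_Suc[OF lim_1_over_n]]) auto
      then show "z \<in> {z. v \<bullet> z = 0}" by simp
    qed (auto simp: B_def)
    moreover have "(\<lambda>k. prob (B v k)) \<longlonglongrightarrow> prob (\<Inter>k. B v k)"
      using B_meas sets dec by (intro finite_Lim_measure_decseq) auto
    ultimately have "(\<lambda>k. prob (B v k)) \<longlonglongrightarrow> 0" using null[OF that] by simp
    then have "\<forall>\<^sub>F k in sequentially. prob (B v k) < 1/2"
      by (rule order_tendstoD) simp
    then show ?thesis by (auto simp: eventually_sequentially)
  qed
  then obtain k where k: "\<And>v. v \<noteq> 0 \<Longrightarrow> prob (B v (k v)) < 1/2" by metis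
  \<comment> \<open>On the ball of radius \<open>Suc (k v)\<close>, a tilt smaller than
    \<open>\<eta> v\<close> costs at most half of the threshold \<open>1 / Suc (k v)\<close>; the
    other half is reserved for \<open>\<delta>\<close>.\<close>
  define \<eta> where "\<eta> v = 1 / (2 * real (Suc (k v)) * real (Suc (k v)))" for v
  have \<eta>_pos: "0 < \<eta> v" for v unfolding \<eta>_def by simp
  have "sphere (0 :: 'b) 1 \<subseteq> (\<Union>c\<in>sphere 0 1. ball c (\<eta> c))" using \<eta>_pos by auto
  then obtain T where T: "T \<subseteq> sphere (0 :: 'b) 1" "finite T" "sphere 0 1 \<subseteq> (\<Union>c\<in>T. ball c (\<eta> c))"
    using compactE_image[of "sphere (0::'b) 1" "sphere 0 1" "\<lambda>c. ball c (\<eta> c)"] by auto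
  \<comment> \<open>The inserted 1 ensures that the minimum is taken over a nonempty set.\<close>
  define \<delta> where "\<delta> = Min (insert 1 ((\<lambda>v. 1 / (2 * real (Suc (k v)))) ` T))"
  show ?thesis
  proof (rule that[of \<delta> T "\<lambda>v. B v (k v)"])
    show "0 < \<delta>" unfolding \<delta>_def using T(2) by (subst Min_gr_iff) auto
    show "finite T" by fact
    show "\<forall>t\<in>T. B t (k t) \<in> sets borel \<and> measure Q (B t (k t)) < 1/2"
    proof
      fix t assume "t \<in> T"
      then have "t \<noteq> 0" using T(1) by auto
      then show "B t (k t) \<in> sets borel \<and> measure Q (B t (k t)) < 1/2" using k B_meas by blast
    qed
    show "\<forall>v. norm v = 1 \<longrightarrow> (\<exists>t\<in>T. \<forall>z. \<bar>v \<bullet> z\<bar> < \<delta> \<longrightarrow> z \<in> B t (k t))"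
    proof (intro allI impI)
      fix v :: 'b assume v: "norm v = 1"
      from T(3) v obtain t where t: "t \<in> T" "norm (t - v) < \<eta> t"
        by (auto simp: subset_iff dist_norm)
      define m where "m = real (Suc (k t))"
      have m: "1 \<le> m" by (simp add: m_def)
      have "\<delta> \<le> 1 / (2 * m)" unfolding \<delta>_def m_def using T(2) t(1) by (intro Min_le) auto
      have "z \<in> B t (k t)" if z: "\<bar>v \<bullet> z\<bar> < \<delta>" for z
      proof (cases "norm z \<le> k t")
        case True
        then have "norm z \<le> m" by (simp add: m_def)
        have "\<bar>(t - v) \<bullet> z\<bar> \<le> norm (t - v) * norm z" by (rule Cauchy_Schwarz_ineq2)
        also have "\<dots> \<le> \<eta> t * m" using t(2) \<open>norm z \<le> m\<close> \<eta>_pos[of t] by (intro mult_mono) auto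
        also have "\<dots> = 1 / (2 * m)" unfolding \<eta>_def m_def[symmetric] using m by (simp add: field_simps)
        finally have "\<bar>t \<bullet> z\<bar> \<le> 1 / (2 * m) + 1 / (2 * m)"
          using z \<open>\<delta> \<le> 1 / (2 * m)\<close> by (simp add: inner_diff_left)
        also have "\<dots> = 1 / m" by simp
        finally show ?thesis by (simp add: B_def m_def)
      qed (simp add: B_def)
      then show "\<exists>t\<in>T. \<forall>z. \<bar>v \<bullet> z\<bar> < \<delta> \<longrightarrow> z \<in> B t (k t)" using t(1) by blast
    qed
  qed
qed

text \<open>The quantifier over \<open>v\<close> stands inside the event. One law of large numbers
  per covering set \<open>A t\<close> suffices: its mass is below 1/2, so it eventually holds at
  most half of the sample, and the points outside it are far from every hyperplane it
  serves.\<close>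

lemma (in prob_space) whp_half_away_from_all_hyperplanes:
  fixes Z :: "nat \<Rightarrow> 'a \<Rightarrow> 'b :: euclidean_space"
  assumes indep: "indep_vars (\<lambda>_. borel) Z UNIV"
    and law: "\<And>i. distr M borel (Z i) = Q"
    and null: "\<And>v. v \<noteq> 0 \<Longrightarrow> measure Q {z. v \<bullet> z = 0} = 0"
  shows "\<exists>\<delta>>0. whp M (\<lambda>n \<omega>. \<forall>v. n / 2 \<le> (\<Sum>i<n. indicator {z. \<delta> * norm v \<le> \<bar>v \<bullet> z\<bar>} (Z i \<omega>) :: real))"
proof -
  have [measurable]: "random_variable borel (Z i)" for i
    using indep by (auto simp: indep_vars_def)
  have Q: "prob_space Q" unfolding law[of 0, symmetric] by (rule prob_space_distr) simp
  then interpret Q: prob_space Q .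
  have sets[measurable_cong]: "sets Q = sets borel" unfolding law[of 0, symmetric] by simp
  obtain \<delta> and T :: "'b set" and A where \<delta>: "0 < \<delta>" and T: "finite T"
    and A: "\<forall>t\<in>T. A t \<in> sets borel \<and> measure Q (A t) < 1/2"
    and cover: "\<forall>v. norm v = 1 \<longrightarrow> (\<exists>t\<in>T. \<forall>z. \<bar>v \<bullet> z\<bar> < \<delta> \<longrightarrow> z \<in> A t)"
    by (rule compact_sphere_cover_hyperplanes[OF Q sets null])
  have "whp M (\<lambda>n \<omega>. (\<Sum>i<n. indicator (A t) (Z i \<omega>)) \<le> n / (2::real))" if "t \<in> T" for t
  proof -
    have [measurable]: "A t \<in> sets borel" using A that by blast
    have "integrable Q (\<lambda>z. (indicator (A t) z :: real)\<^sup>2)"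
      by (rule Q.integrable_const_bound[of _ 1]) (auto simp: indicator_def)
    then have "whp M (\<lambda>n \<omega>. \<bar>(\<Sum>i<n. indicator (A t) (Z i \<omega>)) - n * (\<integral>z. indicator (A t) z \<partial>Q)\<bar>
        < n * (1/2 - measure Q (A t)))"
      using bspec[OF A that] by (intro weak_law_of_large_numbers[OF indep law]) auto
    then show ?thesis
    proof (rule whp_mono, intro always_eventually allI ballI impI)
      fix n \<omega>
      assume "\<bar>(\<Sum>i<n. indicator (A t) (Z i \<omega>)) - n * (\<integral>z. indicator (A t) z \<partial>Q)\<bar>
        < n * (1/2 - measure Q (A t))"
      then have "\<bar>(\<Sum>i<n. indicator (A t) (Z i \<omega>)) - n * measure Q (A t)\<bar>
        < n / 2 - n * measure Q (A t)"
        by (simp add: sets_eq_imp_space_eq[OF sets] right_diff_distrib)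
      then show "(\<Sum>i<n. indicator (A t) (Z i \<omega>)) \<le> n / (2::real)" by linarith
    qed
  qed
  then have "whp M (\<lambda>n \<omega>. \<forall>t\<in>T. (\<Sum>i<n. indicator (A t) (Z i \<omega>)) \<le> n / (2::real))"
    by (intro whp_ball T)
  then have "whp M (\<lambda>n \<omega>. \<forall>v. n / 2 \<le> (\<Sum>i<n. indicator {z. \<delta> * norm v \<le> \<bar>v \<bullet> z\<bar>} (Z i \<omega>) :: real))"
  proof (rule whp_mono, intro always_eventually allI ballI impI)
    fix n \<omega> v
    assume *: "\<forall>t\<in>T. (\<Sum>i<n. indicator (A t) (Z i \<omega>)) \<le> n / (2::real)"
    show "n / 2 \<le> (\<Sum>i<n. indicator {z. \<delta> * norm v \<le> \<bar>v \<bullet> z\<bar>} (Z i \<omega>) :: real)"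
    proof (cases "v = 0")
      case False
      \<comment> \<open>The condition is homogeneous in \<open>v\<close>, so the cover of the unit
        sphere handles every nonzero \<open>v\<close>.\<close>
      then have "norm (v /\<^sub>R norm v) = 1" by simp
      from cover[rule_format, OF this] obtain t where t: "t \<in> T" and
        sub: "\<And>z. \<bar>(v /\<^sub>R norm v) \<bullet> z\<bar> < \<delta> \<Longrightarrow> z \<in> A t" by blast
      have "real n - n / 2 \<le> real n - (\<Sum>i<n. indicat_real (A t) (Z i \<omega>))"
        using * t by (intro diff_left_mono) auto
      also have "\<dots> = (\<Sum>i<n. 1 - indicat_real (A t) (Z i \<omega>))" by (simp add: sum_subtractf)
      also have "\<dots> \<le> (\<Sum>i<n. indicator {z. \<delta> * norm v \<le> \<bar>v \<bullet> z\<bar>} (Z i \<omega>))"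
      proof (rule sum_mono)
        fix i
        have "Z i \<omega> \<in> A t" if "\<not> \<delta> * norm v \<le> \<bar>v \<bullet> Z i \<omega>\<bar>"
          using that False by (intro sub) (simp add: abs_mult field_simps)
        then show "1 - indicator (A t) (Z i \<omega>) \<le>
            (indicator {z. \<delta> * norm v \<le> \<bar>v \<bullet> z\<bar>} (Z i \<omega>) :: real)"
          by (auto simp: indicator_def)
      qed
      finally show ?thesis by simp
    qed simp
  qed
  with \<delta> show ?thesis by blast
qed

section \<open>Coercivity of the log likelihood\<close>

text \<open>Log density of one observation, with the parameter \<open>(\<beta>, s)\<close> and the
  observation \<open>(x, y)\<close> packed into points of Euclidean spaces. It is faithful only for
  positive \<open>f\<close>, as \<open>ln\<close> cannot take the value -infinity.\<close>

definition logdens :: "(real \<Rightarrow> real) \<Rightarrow> ('x :: euclidean_space) \<times> real \<Rightarrow> 'x \<times> real \<Rightarrow> real" where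
  "logdens f \<theta> z = ln (f ((snd z - fst \<theta> \<bullet> fst z) / snd \<theta>)) - ln (snd \<theta>)"

text \<open>The bound drops along each way of leaving a compact set: for small \<open>s\<close> the
  power term beats \<open>- ln s\<close>, for large \<open>s\<close> the term \<open>- ln s\<close>
  suffices, and for intermediate \<open>s\<close> a large \<open>\<beta>\<close> inflates the power
  term.\<close>

lemma logdens_coercive_bound:
  fixes L C \<delta> \<alpha> :: real
  assumes "0 < \<alpha>" "0 < \<delta>" "0 < C"
  obtains K :: "('x :: euclidean_space \<times> real) set" where "compact K" "K \<subseteq> UNIV \<times> {0<..}"
    "\<And>\<beta> s. 0 < s \<Longrightarrow> (\<beta>, s) \<notin> K \<Longrightarrow>
       ln C - ln s - (\<delta> * norm (- \<beta>, 1 :: real) / s) powr \<alpha> / 2 < L"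
proof -
  \<comment> \<open>This solves \<open>ln C - ln b = L\<close>: above \<open>b\<close> the bound is
    below \<open>L\<close> even when the power term is dropped.\<close>
  define b where "b = exp (ln C - L)"
  \<comment> \<open>The component 1 makes the norm of \<open>(- \<beta>, 1)\<close> at least 1, so
    \<open>\<delta>\<close> alone gives an estimate uniform in \<open>\<beta>\<close>.\<close>
  have "filterlim (\<lambda>s. ln C - ln s - (\<delta> / s) powr \<alpha> / 2) at_bot (at_right 0)"
    using assms by real_asymp
  then have "\<forall>\<^sub>F s in at_right 0. ln C - ln s - (\<delta> / s) powr \<alpha> / 2 < L"
    by (simp add: filterlim_at_bot_dense)
  then obtain a where a: "0 < a" "\<And>s. 0 < s \<Longrightarrow> s < a \<Longrightarrow> ln C - ln s - (\<delta> / s) powr \<alpha> / 2 < L"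
    by (auto simp: eventually_at_right_field)
  have "0 < b" by (simp add: b_def)
  \<comment> \<open>Worst case on the strip between \<open>a\<close> and \<open>b\<close>: the
    logarithm is evaluated at \<open>a\<close>, the power term at \<open>b\<close>.\<close>
  then have "filterlim (\<lambda>R. ln C - ln a - (\<delta> * R / b) powr \<alpha> / 2) at_bot at_top"
    using assms by real_asymp
  then have "\<forall>\<^sub>F R in at_top. ln C - ln a - (\<delta> * R / b) powr \<alpha> / 2 < L"
    by (simp add: filterlim_at_bot_dense)
  then obtain R0 where R0: "\<And>R. R0 \<le> R \<Longrightarrow> ln C - ln a - (\<delta> * R / b) powr \<alpha> / 2 < L"
    by (auto simp: eventually_at_top_linorder)
  define R where "R = max 1 R0"
  have R: "0 < R" "ln C - ln a - (\<delta> * R / b) powr \<alpha> / 2 < L"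
    using R0[of R] by (auto simp: R_def)
  show ?thesis
  proof (rule that[of "cball 0 R \<times> {a..b}"])
    show "compact (cball (0 :: 'x) R \<times> {a..b})" by (intro compact_Times) auto
    show "cball (0 :: 'x) R \<times> {a..b} \<subseteq> UNIV \<times> {0<..}" using a(1) by auto
    fix \<beta> :: 'x and s :: real
    assume s: "0 < s" and out: "(\<beta>, s) \<notin> cball 0 R \<times> {a..b}"
    define r where "r = \<delta> * norm (- \<beta>, 1 :: real)"
    have r1: "\<delta> \<le> r" and r2: "\<delta> * norm \<beta> \<le> r"
      using \<open>0 < \<delta>\<close> norm_fst_le[of "- \<beta>" "1::real"] norm_snd_le[of "1::real" "- \<beta>"] by (auto simp: r_def)
    consider "s < a" | "b < s" | "a \<le> s" "s \<le> b" "R < norm \<beta>" using out by fastforce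
    then show "ln C - ln s - (\<delta> * norm (- \<beta>, 1 :: real) / s) powr \<alpha> / 2 < L"
      unfolding r_def[symmetric]
    proof cases
      case 1
      have "(\<delta> / s) powr \<alpha> \<le> (r / s) powr \<alpha>"
        using r1 s assms by (intro powr_mono2 divide_right_mono) auto
      then show "ln C - ln s - (r / s) powr \<alpha> / 2 < L" using a(2)[OF s 1] by simp
    next
      case 2
      then have "ln b < ln s" using \<open>0 < b\<close> s by simp
      then show "ln C - ln s - (r / s) powr \<alpha> / 2 < L"
        using powr_ge_zero[of "r / s" \<alpha>] unfolding b_def ln_exp by linarith
    next
      case 3
      have "\<delta> * R / b \<le> r / s"
      proof (rule frac_le)
        have "\<delta> * R \<le> \<delta> * norm \<beta>" using 3 \<open>0 < \<delta>\<close> by simp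
        then show "\<delta> * R \<le> r" using r2 by simp
      qed (use 3 s r1 \<open>0 < \<delta>\<close> in auto)
      then have "(\<delta> * R / b) powr \<alpha> \<le> (r / s) powr \<alpha>"
        using R assms \<open>0 < b\<close> by (intro powr_mono2) auto
      moreover have "ln a \<le> ln s" using 3 a(1) s by simp
      ultimately show "ln C - ln s - (r / s) powr \<alpha> / 2 < L" using R(2) by linarith
    qed
  qed
qed

text \<open>Strict positivity is assumed here so that all log densities are real; the final proof
  derives it from (A8).\<close>

locale positive_unimodal_density =
  fixes f :: "real \<Rightarrow> real" and \<alpha> C :: real
  assumes pos: "0 < f t"
    and even: "f (- t) = f t"
    and antimono: "antimono_on {0..} f"
    and continuous: "continuous_on UNIV f"
    and mass: "(\<integral>\<^sup>+t. ennreal (f t) \<partial>lborel) = 1"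
    and alpha_pos: "0 < \<alpha>" and C_pos: "0 < C"
    and decay: "f t \<le> C * exp (- (\<bar>t\<bar> powr \<alpha>))"
begin

lemma measurable_f[measurable]: "f \<in> borel_measurable borel"
  using continuous by (rule borel_measurable_continuous_onI)

lemma isCont_f: "isCont f t"
  using continuous by (simp add: continuous_on_eq_continuous_at)

lemma f_abs: "f \<bar>t\<bar> = f t"
  by (simp add: abs_if even)

lemma f_mono_abs: "\<bar>u\<bar> \<le> \<bar>t\<bar> \<Longrightarrow> f t \<le> f u"
  using monotone_onD[OF antimono, of "\<bar>u\<bar>" "\<bar>t\<bar>"] by (simp add: f_abs)

lemma ln_f_mono_abs: "\<bar>u\<bar> \<le> \<bar>t\<bar> \<Longrightarrow> ln (f t) \<le> ln (f u)"
  using f_mono_abs pos by (simp only: ln_le_cancel_iff)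

lemma measurable_logdens[measurable]:
  "(\<lambda>z. logdens f \<theta> z) \<in> borel_measurable (borel :: ('x :: euclidean_space \<times> real) measure)"
  unfolding logdens_def borel_prod[symmetric] by measurable

lemma continuous_on_logdens:
  "continuous_on (UNIV \<times> {0<..}) (\<lambda>\<theta>. logdens f \<theta> z)"
  unfolding logdens_def
  by (intro continuous_intros continuous_on_compose2[OF continuous]) (simp_all add: mem_Times_iff pos[THEN less_imp_neq, symmetric] split_beta)

lemma ln_f_le: "ln (f t) \<le> ln C - \<bar>t\<bar> powr \<alpha>"
proof -
  have "ln (f t) \<le> ln (C * exp (- (\<bar>t\<bar> powr \<alpha>)))"
    using decay[of t] pos[of t] C_pos by simp
  also have "\<dots> = ln C - \<bar>t\<bar> powr \<alpha>" using C_pos by (simp add: ln_mult)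
  finally show ?thesis .
qed

text \<open>Every summand is at most \<open>ln C - ln s\<close>, and by (A4) each of the at least
  \<open>n / 2\<close> large residuals lowers this by the full power term.\<close>

lemma sum_logdens_le:
  fixes n :: nat and z :: "nat \<Rightarrow> 'x :: euclidean_space \<times> real"
  assumes s: "0 < s" and \<delta>: "0 < \<delta>"
    and half: "n / 2 \<le> (\<Sum>i<n. indicator {z. \<delta> * norm (- \<beta>, 1 :: real) \<le> \<bar>(- \<beta>, 1 :: real) \<bullet> z\<bar>} (z i) :: real)"
  shows "(\<Sum>i<n. logdens f (\<beta>, s) (z i)) \<le>
     n * (ln C - ln s - (\<delta> * norm (- \<beta>, 1 :: real) / s) powr \<alpha> / 2)"
proof -
  define v where "v = (- \<beta>, 1 :: real)"
  define r where "r = (\<delta> * norm v / s) powr \<alpha>"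
  let ?I = "\<lambda>i. indicator {z. \<delta> * norm v \<le> \<bar>v \<bullet> z\<bar>} (z i) :: real"
  have "logdens f (\<beta>, s) (z i) \<le> ln C - ln s - r * ?I i" for i
  proof -
    let ?u = "(snd (z i) - \<beta> \<bullet> fst (z i)) / s"
    \<comment> \<open>The residual is the inner product of the observation with
      \<open>(- \<beta>, 1)\<close>; this is how distance from hyperplanes enters.\<close>
    have u: "\<bar>?u\<bar> = \<bar>v \<bullet> z i\<bar> / s"
      using s by (cases "z i") (simp add: v_def)
    have "r * ?I i \<le> \<bar>?u\<bar> powr \<alpha>"
      unfolding u r_def using s \<delta> alpha_pos
      by (auto simp: indicator_def intro!: powr_mono2 divide_right_mono)
    then show ?thesis using ln_f_le[of ?u] by (simp add: logdens_def)
  qed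
  then have "(\<Sum>i<n. logdens f (\<beta>, s) (z i)) \<le> (\<Sum>i<n. ln C - ln s - r * ?I i)"
    by (rule sum_mono)
  also have "\<dots> = n * (ln C - ln s) - r * (\<Sum>i<n. ?I i)"
    by (simp add: sum_subtractf sum_distrib_left)
  also have "\<dots> \<le> n * (ln C - ln s) - r * (n / 2)"
    using half by (intro diff_left_mono mult_left_mono) (auto simp: r_def v_def)
  finally show ?thesis by (simp add: r_def v_def algebra_simps)
qed

end

section \<open>Identifiability and local bounds\<close>

text \<open>The set of disagreement is open and Lebesgue null, hence empty.\<close>

lemma AE_lborel_eq_imp_eq:
  fixes g h :: "'a :: euclidean_space \<Rightarrow> real"
  assumes "AE t in lborel. g t = h t" "continuous_on UNIV g" "continuous_on UNIV h"
  shows "g t = h t"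
proof -
  define U where "U = {t. g t \<noteq> h t}"
  have op: "open U"
    unfolding U_def by (rule open_Collect_neq[OF assms(2,3)])
  have "emeasure lborel U = 0"
    using assms(1) AE_iff_measurable[of U lborel "\<lambda>t. g t = h t"] op by (auto simp: U_def)
  then have "U \<in> null_sets lebesgue"
    using op by (intro null_sets_completionI) auto
  then have "negligible U" by (simp add: negligible_iff_null_sets)
  then have "U = {}" using op open_not_negligible by blast
  then show ?thesis by (auto simp: U_def)
qed

context positive_unimodal_density
begin

text \<open>Comparing the peak heights of the two densities gives equal scales. A nonzero shift
  would then be a period of \<open>f\<close>, which the decay excludes.\<close>

lemma scale_shift_unique:
  assumes s: "0 < s" "0 < s0" and eq: "\<And>t. f ((t + c) / s) / s = f (t / s0) / s0"
  shows "s = s0 \<and> c = 0"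
proof
  \<comment> \<open>The peak of the left side is at \<open>- c\<close>, that of the right side at 0;
    each is compared with the other side at the same point.\<close>
  have "f (c / s) \<le> f 0" "f (- c / s0) \<le> f 0" by (intro f_mono_abs; simp)+
  moreover have "f 0 / s = f (- c / s0) / s0" "f (c / s) / s = f 0 / s0"
    using eq[of "- c"] eq[of 0] by simp_all
  ultimately have "f 0 / s \<le> f 0 / s0" "f 0 / s0 \<le> f 0 / s"
    using s by (metis divide_right_mono less_imp_le)+
  then have "f 0 / s = f 0 / s0" by simp
  then show "s = s0" using s pos[of 0] by (simp add: field_simps)
  then have per: "f (t + c / s) = f t" for t
    using eq[of "t * s"] s by (simp add: add_divide_distrib)
  \<comment> \<open>Stepping by the period carries the value \<open>f 0\<close> out to
    infinity.\<close>
  have f_mult: "f (of_nat n * (c / s)) = f 0" for n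
  proof (induction n)
    case (Suc n)
    have "f (of_nat (Suc n) * (c / s)) = f (of_nat n * (c / s) + c / s)"
      by (simp only: of_nat_Suc distrib_right mult_1 add.commute)
    also have "\<dots> = f 0" using per Suc by simp
    finally show ?case .
  qed simp
  show "c = 0"
  proof (rule ccontr)
    assume "c \<noteq> 0"
    define a where "a = \<bar>c / s\<bar>"
    have "0 < a" using \<open>c \<noteq> 0\<close> s by (simp add: a_def)
    then have "(\<lambda>n. C * exp (- ((real n * a) powr \<alpha>))) \<longlonglongrightarrow> 0"
      using alpha_pos C_pos by real_asymp
    moreover have "f 0 \<le> C * exp (- ((real n * a) powr \<alpha>))" for n
      using decay[of "of_nat n * (c / s)"] f_mult[of n] by (simp add: abs_mult a_def)
    ultimately have "f 0 \<le> 0" by (intro LIMSEQ_le_const) auto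
    then show False using pos[of 0] by simp
  qed
qed

lemma exp_logdens:
  "0 < snd \<theta> \<Longrightarrow> exp (logdens f \<theta> z) = f ((snd z - fst \<theta> \<bullet> fst z) / snd \<theta>) / snd \<theta>"
  unfolding logdens_def exp_diff using pos by simp

lemma nn_integral_scale_shift:
  assumes "0 < s"
  shows "(\<integral>\<^sup>+t. ennreal (f ((t + c) / s) / s) \<partial>lborel) = 1"
proof -
  have "(\<integral>\<^sup>+t. ennreal (f ((t + c) / s) / s) \<partial>lborel)
      = ennreal s * (\<integral>\<^sup>+u. ennreal (f ((- c + s * u + c) / s) / s) \<partial>lborel)"
    using assms by (subst nn_integral_real_affine[of _ s "- c"]) auto
  also have "\<dots> = (\<integral>\<^sup>+u. ennreal s * ennreal (f u / s) \<partial>lborel)"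
    using assms by (subst nn_integral_cmult) auto
  also have "\<dots> = (\<integral>\<^sup>+u. ennreal (f u) \<partial>lborel)"
    using assms pos by (intro nn_integral_cong) (simp flip: ennreal_mult'' add: less_imp_le)
  finally show ?thesis using mass by simp
qed

end

section \<open>Law of a single observation\<close>

text \<open>Independence and the error density are encoded in a product measure, (A2) enters as null
  hyperplanes for \<open>D\<close>, and \<open>envelope\<close> is (A8) with a real
  logarithm.\<close>

locale regression_law = positive_unimodal_density +
  fixes D :: "'x :: euclidean_space measure" and \<beta>\<^sub>0 :: 'x and s\<^sub>0 :: real
    and Q :: "('x \<times> real) measure"
  assumes prob_D: "prob_space D" and sets_D[measurable_cong]: "sets D = sets borel"
    and hyperplane_null: "b \<noteq> 0 \<Longrightarrow> measure D {x. b \<bullet> x = 0} = 0"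
    and scale_pos: "0 < s\<^sub>0"
    and law: "Q = distr (D \<Otimes>\<^sub>M density lborel (\<lambda>t. ennreal (f (t / s\<^sub>0) / s\<^sub>0))) borel
        (\<lambda>(x, t). (x, \<beta>\<^sub>0 \<bullet> x + t))"
    and envelope: "0 < R \<Longrightarrow> 0 < a \<Longrightarrow>
        integrable Q (\<lambda>z. (ln (f ((\<bar>snd z\<bar> + R * norm (fst z)) / a)))\<^sup>2)"
begin

abbreviation E :: "real measure" where
  "E \<equiv> density lborel (\<lambda>t. ennreal (f (t / s\<^sub>0) / s\<^sub>0))"

sublocale D: prob_space D by (rule prob_D)

sublocale E: prob_space E
proof
  show "emeasure E (space E) = 1"
    using nn_integral_scale_shift[OF scale_pos, of 0] by (simp add: emeasure_density)
qed

sublocale DE: pair_prob_space D E ..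

lemma measurable_obs[measurable]:
  "(\<lambda>(x, t). (x, \<beta>\<^sub>0 \<bullet> x + t)) \<in> measurable (D \<Otimes>\<^sub>M E) borel"
  unfolding borel_prod[symmetric] by measurable

sublocale Q: prob_space Q
  unfolding law by (rule DE.prob_space_distr) measurable

lemma sets_Q[measurable_cong, simp]: "sets Q = sets borel"
  by (simp add: law)

lemma space_Q[simp]: "space Q = UNIV"
  by (simp add: law)

text \<open>Since the error density is positive, null sets of \<open>E\<close> are Lebesgue null;
  this later allows continuity in \<open>t\<close> to be exploited.\<close>

lemma AE_Q_imp:
  assumes "AE z in Q. p z" and [measurable]: "Measurable.pred borel p"
  shows "AE x in D. AE t in lborel. p (x, \<beta>\<^sub>0 \<bullet> x + t)"
proof -
  have "AE w in D \<Otimes>\<^sub>M E. p (case w of (x, t) \<Rightarrow> (x, \<beta>\<^sub>0 \<bullet> x + t))"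
    using assms(1) unfolding law by (subst (asm) AE_distr_iff) measurable
  then have "AE x in D. AE t in E. p (x, \<beta>\<^sub>0 \<bullet> x + t)"
    using DE.AE_pair by fastforce
  moreover have "0 < ennreal (f (t / s\<^sub>0) / s\<^sub>0)" for t
    using pos scale_pos by simp
  ultimately show ?thesis
    by (simp add: AE_density)
qed

text \<open>If the response has coefficient zero, this is a hyperplane for the regressor. Otherwise
  each \<open>x\<close> excludes a single value of \<open>t\<close>, a Lebesgue null set.\<close>

lemma null_hyperplane_Q:
  assumes "v \<noteq> 0"
  shows "measure Q {z. v \<bullet> z = 0} = 0"
proof -
  obtain b c where v: "v = (b, c)" by (cases v)
  have "AE x in D. AE t in E. b \<bullet> x + c * (\<beta>\<^sub>0 \<bullet> x + t) \<noteq> 0"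
  proof (cases "c = 0")
    case True
    then have "b \<noteq> 0" using assms v by (auto simp: zero_prod_def)
    have "{x. b \<bullet> x = 0} \<in> sets D" by measurable
    then have "AE x in D. x \<notin> {x. b \<bullet> x = 0}"
      using D.prob_eq_0[of "{x. b \<bullet> x = 0}"] hyperplane_null[OF \<open>b \<noteq> 0\<close>] sets_eq_imp_space_eq[OF sets_D]
      by auto
    then show ?thesis using True by auto
  next
    case False
    have "AE t in E. b \<bullet> x + c * (\<beta>\<^sub>0 \<bullet> x + t) \<noteq> 0" for x
    proof -
      have "AE t in lborel. t \<noteq> - (b \<bullet> x) / c - \<beta>\<^sub>0 \<bullet> x"
        by (rule AE_lborel_singleton)
      then have "AE t in lborel. b \<bullet> x + c * (\<beta>\<^sub>0 \<bullet> x + t) \<noteq> 0"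
        by eventually_elim (use False in \<open>auto simp: field_simps\<close>)
      then show ?thesis
        by (subst AE_density) (measurable, auto elim!: eventually_mono)
    qed
    then show ?thesis by simp
  qed
  then have AE_DE: "AE x in D. AE t in E. v \<bullet> (case (x, t) of (x, t) \<Rightarrow> (x, \<beta>\<^sub>0 \<bullet> x + t)) \<noteq> 0"
    by (simp add: v)
  have pred: "Measurable.pred borel (\<lambda>z. v \<bullet> z \<noteq> 0)" by measurable
  have "{w \<in> space (D \<Otimes>\<^sub>M E). v \<bullet> (case w of (x, t) \<Rightarrow> (x, \<beta>\<^sub>0 \<bullet> x + t)) \<noteq> 0} \<in> sets (D \<Otimes>\<^sub>M E)"
    using measurable_compose[OF measurable_obs pred] by (simp only: pred_def)
  from DE.AE_pair_measure[OF this AE_DE] have "AE z in Q. v \<bullet> z \<noteq> 0"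
    unfolding law using pred by (subst AE_distr_iff[OF measurable_obs]) (simp_all add: pred_def)
  then show ?thesis
    by (subst Q.prob_eq_0) auto
qed

section \<open>Envelopes and local upper bounds\<close>

text \<open>By monotonicity this is a lower bound for the log of \<open>f\<close> at the residual,
  simultaneously for all \<open>\<beta>\<close> of norm at most \<open>R\<close> and scales at least
  \<open>a\<close>.\<close>

definition env :: "real \<Rightarrow> real \<Rightarrow> 'x \<times> real \<Rightarrow> real" where
  "env R a z = ln (f ((\<bar>snd z\<bar> + R * norm (fst z)) / a))"

lemma env_sq: "0 < R \<Longrightarrow> 0 < a \<Longrightarrow> integrable Q (\<lambda>z. (env R a z)\<^sup>2)"
  using envelope by (simp add: env_def)

lemma env_measurable[measurable]: "env R a \<in> borel_measurable borel"
  unfolding env_def borel_prod[symmetric] by measurable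

lemma sq_integrable_env:
  assumes "0 < R" "0 < a" and [measurable]: "h \<in> borel_measurable borel"
    and bound: "\<And>z. \<bar>h z\<bar> \<le> k + \<bar>env R a z\<bar>"
  shows "integrable Q (\<lambda>z. (h z)\<^sup>2)"
proof (rule Bochner_Integration.integrable_bound)
  show "integrable Q (\<lambda>z. 2 * k\<^sup>2 + 2 * (env R a z)\<^sup>2)"
    using env_sq[OF assms(1,2)] by simp
  have "norm ((h z)\<^sup>2) \<le> norm (2 * k\<^sup>2 + 2 * (env R a z)\<^sup>2)" for z
  proof -
    have "(h z)\<^sup>2 \<le> (k + \<bar>env R a z\<bar>)\<^sup>2"
      using bound[of z] by (simp add: abs_le_square_iff[symmetric])
    also have "\<dots> \<le> 2 * k\<^sup>2 + 2 * (env R a z)\<^sup>2"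
      using sum_squares_bound[of k "\<bar>env R a z\<bar>"] by (simp add: power2_sum)
    finally show ?thesis by simp
  qed
  then show "AE z in Q. norm ((h z)\<^sup>2) \<le> norm (2 * k\<^sup>2 + 2 * (env R a z)\<^sup>2)" by simp
qed measurable

text \<open>An explicit bound for the supremum of the log density over the ball of radius \<open>\<rho>\<close> around
  \<open>\<theta>\<close>, available because \<open>f\<close> is even and unimodal. It is visibly measurable and
  continuous in \<open>\<rho>\<close>, so the supremum itself is never needed.\<close>

definition local_sup :: "'x \<times> real \<Rightarrow> real \<Rightarrow> 'x \<times> real \<Rightarrow> real" where
  "local_sup \<theta> \<rho> z =
     ln (f (max 0 (\<bar>snd z - fst \<theta> \<bullet> fst z\<bar> - \<rho> * norm (fst z)) / (snd \<theta> + \<rho>))) - ln (snd \<theta> - \<rho>)"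

lemma local_sup_measurable[measurable]: "local_sup \<theta> \<rho> \<in> borel_measurable borel"
  unfolding local_sup_def borel_prod[symmetric] by measurable

text \<open>Within the ball the absolute residual shrinks by at most \<open>\<rho> * norm x\<close>
  by Cauchy-Schwarz, and the scale stays between \<open>s - \<rho>\<close> and
  \<open>s + \<rho>\<close>.\<close>

lemma logdens_le_local_sup:
  assumes \<rho>: "0 \<le> \<rho>" "\<rho> < snd \<theta>" and dist: "dist \<theta>' \<theta> \<le> \<rho>"
  shows "logdens f \<theta>' z \<le> local_sup \<theta> \<rho> z"
proof -
  obtain \<beta> s \<beta>' s' x y where eqs: "\<theta> = (\<beta>, s)" "\<theta>' = (\<beta>', s')" "z = (x, y)" by (metis surj_pair)
  have d: "norm (\<beta>' - \<beta>) \<le> \<rho>" "\<bar>s' - s\<bar> \<le> \<rho>"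
    using dist dist_fst_le[of \<theta>' \<theta>] dist_snd_le[of \<theta>' \<theta>] by (auto simp: eqs dist_norm)
  then have s': "s - \<rho> \<le> s'" "s' \<le> s + \<rho>" "0 < s - \<rho>" using \<rho> by (auto simp: eqs)
  have "\<bar>(\<beta>' - \<beta>) \<bullet> x\<bar> \<le> \<rho> * norm x"
    using Cauchy_Schwarz_ineq2[of "\<beta>' - \<beta>" x] d(1) mult_right_mono[OF d(1), of "norm x"] by simp
  then have "max 0 (\<bar>y - \<beta> \<bullet> x\<bar> - \<rho> * norm x) \<le> \<bar>y - \<beta>' \<bullet> x\<bar>"
    by (simp add: inner_diff_left abs_le_iff abs_if split: if_splits)
  then have "max 0 (\<bar>y - \<beta> \<bullet> x\<bar> - \<rho> * norm x) / (s + \<rho>) \<le> \<bar>y - \<beta>' \<bullet> x\<bar> / s'"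
    using s' by (intro frac_le) auto
  then have "\<bar>max 0 (\<bar>y - \<beta> \<bullet> x\<bar> - \<rho> * norm x) / (s + \<rho>)\<bar> \<le> \<bar>(y - \<beta>' \<bullet> x) / s'\<bar>"
    using s' \<rho> by (simp add: eqs)
  from ln_f_mono_abs[OF this] show ?thesis
    using s' by (simp add: local_sup_def logdens_def eqs diff_mono)
qed

text \<open>The peak \<open>f 0\<close> bounds from above and the envelope from below. The right
  side is free of \<open>\<rho>\<close>, so it can dominate as \<open>\<rho>\<close> shrinks; the
  added 1 makes the envelope radius positive, as (A8) requires.\<close>

lemma abs_local_sup_le:
  assumes \<rho>: "0 \<le> \<rho>" "\<rho> \<le> snd \<theta> / 2" and s: "0 < snd \<theta>"
  shows "\<bar>local_sup \<theta> \<rho> z\<bar> \<le> (\<bar>ln (f 0)\<bar> + \<bar>ln (snd \<theta>)\<bar> + \<bar>ln (snd \<theta> / 2)\<bar>)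
     + \<bar>env (norm (fst \<theta>) + 1) (snd \<theta>) z\<bar>"
proof -
  obtain \<beta> s x y where eqs: "\<theta> = (\<beta>, s)" "z = (x, y)" by (metis surj_pair)
  let ?u = "max 0 (\<bar>y - \<beta> \<bullet> x\<bar> - \<rho> * norm x) / (s + \<rho>)"
  have s: "0 < s" "\<rho> \<le> s / 2" using assms by (auto simp: eqs)
  have "ln (s / 2) \<le> ln (s - \<rho>)" "ln (s - \<rho>) \<le> ln s"
    using s \<rho> by auto
  moreover have "ln (f ?u) \<le> ln (f 0)" by (rule ln_f_mono_abs) simp
  moreover have "env (norm \<beta> + 1) s z \<le> ln (f ?u)"
    unfolding env_def
  proof (rule ln_f_mono_abs)
    have "\<bar>\<beta> \<bullet> x\<bar> \<le> norm \<beta> * norm x" by (rule Cauchy_Schwarz_ineq2)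
    moreover have "0 \<le> \<rho> * norm x" "0 \<le> norm \<beta> * norm x" using \<rho> by auto
    ultimately have "max 0 (\<bar>y - \<beta> \<bullet> x\<bar> - \<rho> * norm x) \<le> \<bar>y\<bar> + (norm \<beta> * norm x + norm x)"
      using norm_ge_zero[of x] by linarith
    also have "\<dots> = \<bar>y\<bar> + (norm \<beta> + 1) * norm x" by (simp add: algebra_simps)
    finally have "max 0 (\<bar>y - \<beta> \<bullet> x\<bar> - \<rho> * norm x) \<le> \<bar>y\<bar> + (norm \<beta> + 1) * norm x" .
    then have "?u \<le> (\<bar>y\<bar> + (norm \<beta> + 1) * norm x) / s"
      using s \<rho> by (intro frac_le) auto
    then show "\<bar>?u\<bar> \<le> \<bar>(\<bar>snd z\<bar> + (norm \<beta> + 1) * norm (fst z)) / s\<bar>"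
      using s \<rho> by (simp add: eqs)
  qed
  moreover have "\<bar>v\<bar> \<le> \<bar>w\<bar> + \<bar>u\<bar>" if "u \<le> v" "v \<le> w" for u v w :: real
    using that by linarith
  ultimately have "\<bar>ln (f ?u)\<bar> \<le> \<bar>ln (f 0)\<bar> + \<bar>env (norm \<beta> + 1) s z\<bar>"
    and "\<bar>ln (s - \<rho>)\<bar> \<le> \<bar>ln s\<bar> + \<bar>ln (s / 2)\<bar>"
    by blast+
  note order_trans[OF abs_triangle_ineq4 add_mono[OF this]]
  also have "(\<bar>ln (f 0)\<bar> + \<bar>env (norm \<beta> + 1) s z\<bar>) + (\<bar>ln s\<bar> + \<bar>ln (s / 2)\<bar>) =
      (\<bar>ln (f 0)\<bar> + \<bar>ln s\<bar> + \<bar>ln (s / 2)\<bar>) + \<bar>env (norm \<beta> + 1) s z\<bar>"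
    by (simp only: add_ac)
  finally show ?thesis
    unfolding local_sup_def eqs fst_conv snd_conv .
qed

lemma local_sup_sq_integrable:
  assumes "0 \<le> \<rho>" "\<rho> \<le> snd \<theta> / 2" "0 < snd \<theta>"
  shows "integrable Q (\<lambda>z. (local_sup \<theta> \<rho> z)\<^sup>2)"
proof (rule sq_integrable_env[OF _ assms(3) local_sup_measurable abs_local_sup_le[OF assms]])
  show "0 < norm (fst \<theta>) + 1" using norm_ge_zero[of "fst \<theta>"] by linarith
qed

lemma local_sup_0: "local_sup \<theta> 0 z = logdens f \<theta> z"
proof -
  have "f (\<bar>u\<bar> / s) = f (u / s)" for u s :: real
    by (metis abs_divide f_abs abs_abs)
  then show ?thesis by (simp add: local_sup_def logdens_def)
qed

lemma logdens_sq_integrable: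
  assumes "0 < snd \<theta>"
  shows "integrable Q (\<lambda>z. (logdens f \<theta> z)\<^sup>2)"
proof -
  have "local_sup \<theta> 0 = logdens f \<theta>" by (rule ext) (rule local_sup_0)
  then show ?thesis using local_sup_sq_integrable[of 0 \<theta>] assms by simp
qed

lemma logdens_integrable: "0 < snd \<theta> \<Longrightarrow> integrable Q (logdens f \<theta>)"
  by (rule Q.square_integrable_imp_integrable[OF _ logdens_sq_integrable]) simp_all

text \<open>Dominated convergence as the radius tends to 0, where the local bound becomes the log
  density itself.\<close>

lemma local_domination:
  assumes s: "0 < snd \<theta>" and less: "(\<integral>z. logdens f \<theta> z \<partial>Q) < c"
  obtains \<rho> where "0 < \<rho>" "\<rho> \<le> snd \<theta> / 2" "(\<integral>z. local_sup \<theta> \<rho> z \<partial>Q) < c"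
proof -
  \<comment> \<open>The offset 2 keeps every radius at most \<open>snd \<theta> / 2\<close>, the
    range in which the dominating function is valid.\<close>
  define \<rho> where "\<rho> k = snd \<theta> / real (k + 2)" for k
  have \<rho>: "0 < \<rho> k" "\<rho> k \<le> snd \<theta> / 2" for k
    using s by (simp add: \<rho>_def) (unfold \<rho>_def, rule divide_left_mono, use s in auto)
  have "\<rho> \<longlonglongrightarrow> 0"
    unfolding \<rho>_def by real_asymp
  let ?w = "\<lambda>z. (\<bar>ln (f 0)\<bar> + \<bar>ln (snd \<theta>)\<bar> + \<bar>ln (snd \<theta> / 2)\<bar>)
     + \<bar>env (norm (fst \<theta>) + 1) (snd \<theta>) z\<bar>"
  have "(\<lambda>k. \<integral>z. local_sup \<theta> (\<rho> k) z \<partial>Q) \<longlonglongrightarrow> (\<integral>z. local_sup \<theta> 0 z \<partial>Q)"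
  proof (rule integral_dominated_convergence)
    have "0 < norm (fst \<theta>) + 1" using norm_ge_zero[of "fst \<theta>"] by linarith
    then have "integrable Q (env (norm (fst \<theta>) + 1) (snd \<theta>))"
      using s by (intro Q.square_integrable_imp_integrable[OF _ env_sq]) (auto, measurable)
    then show "integrable Q ?w" by simp
    show "AE z in Q. norm (local_sup \<theta> (\<rho> k) z) \<le> ?w z" for k
      using abs_local_sup_le[of "\<rho> k" \<theta>] \<rho>[of k] s by (intro AE_I2) (auto simp: less_imp_le)
    have "(\<lambda>k. local_sup \<theta> (\<rho> k) z) \<longlonglongrightarrow> local_sup \<theta> 0 z" for z
      unfolding local_sup_def
      by (intro tendsto_intros isCont_tendsto_compose[OF isCont_f] \<open>\<rho> \<longlonglongrightarrow> 0\<close>)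
        (use s pos less_imp_neq[OF pos, symmetric] in auto)
    then show "AE z in Q. (\<lambda>k. local_sup \<theta> (\<rho> k) z) \<longlonglongrightarrow> local_sup \<theta> 0 z" by simp
  qed measurable
  then have "\<forall>\<^sub>F k in sequentially. (\<integral>z. local_sup \<theta> (\<rho> k) z \<partial>Q) < c"
    using less by (intro order_tendstoD) (simp_all add: local_sup_0)
  then obtain k where "(\<integral>z. local_sup \<theta> (\<rho> k) z \<partial>Q) < c"
    by (auto simp: eventually_sequentially)
  with \<rho> show ?thesis using that by blast
qed

section \<open>Strict maximality of the expected log density\<close>

text \<open>For fixed \<open>x\<close> the true error density cancels against the denominator,
  leaving a shifted and scaled copy of \<open>f\<close>, which has mass 1.\<close>

lemma expectation_likelihood_ratio:
  assumes s: "0 < snd \<theta>"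
  shows "(\<integral>\<^sup>+z. ennreal (exp (logdens f \<theta> z - logdens f (\<beta>\<^sub>0, s\<^sub>0) z)) \<partial>Q) = 1"
proof -
  let ?r = "\<lambda>z. exp (logdens f \<theta> z - logdens f (\<beta>\<^sub>0, s\<^sub>0) z)"
  have r_meas: "(\<lambda>z. ennreal (?r z)) \<in> borel_measurable borel" by measurable
  have inner: "(\<integral>\<^sup>+t. ennreal (?r (x, \<beta>\<^sub>0 \<bullet> x + t)) \<partial>E) = 1" for x
  proof -
    have [measurable]: "(\<lambda>t. (x, \<beta>\<^sub>0 \<bullet> x + t)) \<in> borel_measurable borel"
      unfolding borel_prod[symmetric] by measurable
    have "(\<integral>\<^sup>+t. ennreal (?r (x, \<beta>\<^sub>0 \<bullet> x + t)) \<partial>E) =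
       (\<integral>\<^sup>+t. ennreal (f (t / s\<^sub>0) / s\<^sub>0) * ennreal (?r (x, \<beta>\<^sub>0 \<bullet> x + t)) \<partial>lborel)"
      by (rule nn_integral_density) measurable
    also have "\<dots> = (\<integral>\<^sup>+t. ennreal (f ((t + (\<beta>\<^sub>0 \<bullet> x - fst \<theta> \<bullet> x)) / snd \<theta>) / snd \<theta>) \<partial>lborel)"
    proof (rule nn_integral_cong)
      fix t
      have "exp (logdens f (\<beta>\<^sub>0, s\<^sub>0) (x, \<beta>\<^sub>0 \<bullet> x + t)) = f (t / s\<^sub>0) / s\<^sub>0"
        using scale_pos by (simp add: exp_logdens)
      moreover have "exp (logdens f \<theta> (x, \<beta>\<^sub>0 \<bullet> x + t)) =
          f ((t + (\<beta>\<^sub>0 \<bullet> x - fst \<theta> \<bullet> x)) / snd \<theta>) / snd \<theta>"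
        using s by (simp add: exp_logdens algebra_simps)
      ultimately show "ennreal (f (t / s\<^sub>0) / s\<^sub>0) * ennreal (?r (x, \<beta>\<^sub>0 \<bullet> x + t)) =
          ennreal (f ((t + (\<beta>\<^sub>0 \<bullet> x - fst \<theta> \<bullet> x)) / snd \<theta>) / snd \<theta>)"
        using pos[of "t / s\<^sub>0"] scale_pos by (simp flip: ennreal_mult' add: exp_diff)
    qed
    also have "\<dots> = 1" by (rule nn_integral_scale_shift[OF s])
    finally show ?thesis .
  qed
  have "(\<integral>\<^sup>+z. ennreal (?r z) \<partial>Q) =
      (\<integral>\<^sup>+w. ennreal (?r (case w of (x, t) \<Rightarrow> (x, \<beta>\<^sub>0 \<bullet> x + t))) \<partial>(D \<Otimes>\<^sub>M E))"
    unfolding law by (rule nn_integral_distr) measurable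
  also have "\<dots> = (\<integral>\<^sup>+x. \<integral>\<^sup>+t. ennreal (?r (x, \<beta>\<^sub>0 \<bullet> x + t)) \<partial>E \<partial>D)"
    using E.nn_integral_fst[OF measurable_compose[OF measurable_obs r_meas]] by simp
  also have "\<dots> = 1"
    by (simp add: inner D.emeasure_space_1)
  finally show ?thesis .
qed

text \<open>Gibbs' inequality with its equality case: \<open>exp d - 1 - d\<close> is nonnegative
  and vanishes only at 0, so failure of the strict inequality makes the two log densities agree
  almost everywhere.\<close>

lemma expectation_logdens_less:
  assumes s: "0 < snd \<theta>" and neq: "\<theta> \<noteq> (\<beta>\<^sub>0, s\<^sub>0)"
  shows "(\<integral>z. logdens f \<theta> z \<partial>Q) < (\<integral>z. logdens f (\<beta>\<^sub>0, s\<^sub>0) z \<partial>Q)"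
proof (rule ccontr)
  assume nless: "\<not> ?thesis"
  let ?d = "\<lambda>z. logdens f \<theta> z - logdens f (\<beta>\<^sub>0, s\<^sub>0) z"
  have int: "integrable Q ?d"
    using s scale_pos by (intro Bochner_Integration.integrable_diff logdens_integrable) auto
  have int_exp: "integrable Q (\<lambda>z. exp (?d z))"
    using expectation_likelihood_ratio[OF s] by (intro integrableI_nonneg) auto
  have "(\<integral>z. exp (?d z) \<partial>Q) = 1"
    using expectation_likelihood_ratio[OF s] by (subst integral_eq_nn_integral) auto
  \<comment> \<open>The likelihood ratio has mean 1, so only minus the mean of \<open>?d\<close>
    survives, and the negated claim makes that nonpositive.\<close>
  then have "(\<integral>z. exp (?d z) - 1 - ?d z \<partial>Q) = - (\<integral>z. ?d z \<partial>Q)"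
    using int int_exp Q.prob_space by simp
  also have "\<dots> \<le> 0"
    using nless s scale_pos by (subst Bochner_Integration.integral_diff) (auto intro: logdens_integrable)
  finally have le: "(\<integral>z. exp (?d z) - 1 - ?d z \<partial>Q) \<le> 0" .
  have nonneg: "0 \<le> exp (?d z) - 1 - ?d z" for z
    using exp_ge_add_one_self[of "?d z"] by linarith
  have "(\<integral>z. exp (?d z) - 1 - ?d z \<partial>Q) = 0"
    using le nonneg by (intro antisym Bochner_Integration.integral_nonneg)
  then have "AE z in Q. exp (?d z) - 1 - ?d z = 0"
    using nonneg int int_exp by (subst (asm) integral_nonneg_eq_0_iff_AE) auto
  then have "AE z in Q. ?d z = 0"
  proof eventually_elim
    fix z assume "exp (?d z) - 1 - ?d z = 0"
    then show "?d z = 0" using ln_eq_minus_one[of "exp (?d z)"] by simp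
  qed
  then have "AE x in D. AE t in lborel. ?d (x, \<beta>\<^sub>0 \<bullet> x + t) = 0"
    by (rule AE_Q_imp) measurable
  then have "AE x in D. snd \<theta> = s\<^sub>0 \<and> (\<beta>\<^sub>0 - fst \<theta>) \<bullet> x = 0"
  proof eventually_elim
    fix x assume "AE t in lborel. ?d (x, \<beta>\<^sub>0 \<bullet> x + t) = 0"
    then have *: "AE t in lborel. f ((t + (\<beta>\<^sub>0 - fst \<theta>) \<bullet> x) / snd \<theta>) / snd \<theta> = f (t / s\<^sub>0) / s\<^sub>0"
    proof eventually_elim
      fix t assume "?d (x, \<beta>\<^sub>0 \<bullet> x + t) = 0"
      then have "exp (logdens f \<theta> (x, \<beta>\<^sub>0 \<bullet> x + t)) = exp (logdens f (\<beta>\<^sub>0, s\<^sub>0) (x, \<beta>\<^sub>0 \<bullet> x + t))"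
        by simp
      then show "f ((t + (\<beta>\<^sub>0 - fst \<theta>) \<bullet> x) / snd \<theta>) / snd \<theta> = f (t / s\<^sub>0) / s\<^sub>0"
        using s scale_pos by (simp add: exp_logdens algebra_simps)
    qed
    \<comment> \<open>Continuity upgrades almost every \<open>t\<close> to every \<open>t\<close>,
      as identifiability evaluates at specific points.\<close>
    have "f ((t + (\<beta>\<^sub>0 - fst \<theta>) \<bullet> x) / snd \<theta>) / snd \<theta> = f (t / s\<^sub>0) / s\<^sub>0" for t
      using s scale_pos
      by (intro AE_lborel_eq_imp_eq[OF *] continuous_intros continuous_on_compose2[OF continuous]) auto
    then show "snd \<theta> = s\<^sub>0 \<and> (\<beta>\<^sub>0 - fst \<theta>) \<bullet> x = 0"
      by (rule scale_shift_unique[OF s scale_pos])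
  qed
  then have "AE x in D. snd \<theta> = s\<^sub>0" and AE0: "AE x in D. (\<beta>\<^sub>0 - fst \<theta>) \<bullet> x = 0"
    by auto
  then have "snd \<theta> = s\<^sub>0" by simp
  then have "\<beta>\<^sub>0 - fst \<theta> \<noteq> 0" using neq by (cases \<theta>) auto
  then have "measure D {x. (\<beta>\<^sub>0 - fst \<theta>) \<bullet> x = 0} = 0" by (rule hyperplane_null)
  moreover have "measure D {x. (\<beta>\<^sub>0 - fst \<theta>) \<bullet> x = 0} = 1"
    using AE0 D.prob_eq_1[of "{x. (\<beta>\<^sub>0 - fst \<theta>) \<bullet> x = 0}"] sets_D by simp
  ultimately show False by simp
qed

end

section \<open>Consistency\<close>

context regression_law
begin

text \<open>Existence of a maximizer is part of the event because the estimator is constrained only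
  on samples that admit one.\<close>

lemma consistency:
  fixes M :: "'w measure" and Z :: "nat \<Rightarrow> 'w \<Rightarrow> 'x \<times> real"
  assumes "prob_space M"
    and indep: "prob_space.indep_vars M (\<lambda>_. borel) Z UNIV"
    and Z_law: "\<And>i. distr M borel (Z i) = Q"
    and e: "0 < e" "e < s\<^sub>0"
  defines "S \<equiv> \<lambda>n \<omega> \<theta>. \<Sum>i<n. logdens f \<theta> (Z i \<omega>)"
  shows "whp M (\<lambda>n \<omega>. (\<exists>\<theta>. 0 < snd \<theta> \<and> (\<forall>\<theta>'. 0 < snd \<theta>' \<longrightarrow> S n \<omega> \<theta>' \<le> S n \<omega> \<theta>)) \<and>
    (\<forall>\<theta>. 0 < snd \<theta> \<longrightarrow> (\<forall>\<theta>'. 0 < snd \<theta>' \<longrightarrow> S n \<omega> \<theta>' \<le> S n \<omega> \<theta>) \<longrightarrow> dist \<theta> (\<beta>\<^sub>0, s\<^sub>0) < e))"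
proof -
  interpret M: prob_space M by fact
  note lln = M.weak_law_of_large_numbers[OF indep Z_law]
  have lln_less: "whp M (\<lambda>n \<omega>. (\<Sum>i<n. h (Z i \<omega>)) < n * c)"
    if "h \<in> borel_measurable borel" "integrable Q (\<lambda>z. (h z)\<^sup>2)" "(\<integral>z. h z \<partial>Q) < c"
    for h and c :: real
  proof -
    have "whp M (\<lambda>n \<omega>. \<bar>(\<Sum>i<n. h (Z i \<omega>)) - n * (\<integral>z. h z \<partial>Q)\<bar> < n * (c - (\<integral>z. h z \<partial>Q)))"
      using that by (intro lln) auto
    then show ?thesis
      by (rule whp_mono) (auto simp: right_diff_distrib abs_less_iff)
  qed
  define \<theta>\<^sub>0 where "\<theta>\<^sub>0 = (\<beta>\<^sub>0, s\<^sub>0)"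
  define \<mu> where "\<mu> \<theta> = (\<integral>z. logdens f \<theta> z \<partial>Q)" for \<theta>
  have pos0: "0 < snd \<theta>\<^sub>0" using scale_pos by (simp add: \<theta>\<^sub>0_def)
  have lln_greater: "whp M (\<lambda>n \<omega>. n * c < S n \<omega> \<theta>\<^sub>0)" if "c < \<mu> \<theta>\<^sub>0" for c :: real
  proof -
    have "whp M (\<lambda>n \<omega>. (\<Sum>i<n. - logdens f \<theta>\<^sub>0 (Z i \<omega>)) < n * (- c))"
      using that logdens_sq_integrable[OF pos0] by (intro lln_less) (auto simp: \<mu>_def)
    then show ?thesis
      by (rule whp_mono) (auto simp: S_def sum_negf)
  qed
  obtain \<delta> where \<delta>: "0 < \<delta>" and half: "whp M (\<lambda>n \<omega>. \<forall>v. n / 2 \<le>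
      (\<Sum>i<n. indicator {z. \<delta> * norm v \<le> \<bar>v \<bullet> z\<bar>} (Z i \<omega>) :: real))"
    using M.whp_half_away_from_all_hyperplanes[OF indep Z_law null_hyperplane_Q] by blast
  \<comment> \<open>A level strictly below the limiting average at the true parameter, so that
    parameters outside \<open>K\<close> lose to it.\<close>
  define L where "L = \<mu> \<theta>\<^sub>0 - 1"
  obtain K :: "('x \<times> real) set" where K: "compact K" "K \<subseteq> UNIV \<times> {0<..}" and
    coercive: "\<And>\<beta> s. 0 < s \<Longrightarrow> (\<beta>, s) \<notin> K \<Longrightarrow>
       ln C - ln s - (\<delta> * norm (- \<beta>, 1 :: real) / s) powr \<alpha> / 2 < L"
    by (rule logdens_coercive_bound[OF alpha_pos \<delta> C_pos]) blast
  define K' where "K' = K - ball \<theta>\<^sub>0 e"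
  have "compact K'" unfolding K'_def using K(1) by (intro compact_diff) auto
  have "\<exists>\<rho> c. 0 < \<rho> \<and> \<rho> \<le> snd \<theta> / 2 \<and> (\<integral>z. local_sup \<theta> \<rho> z \<partial>Q) < c \<and> c < \<mu> \<theta>\<^sub>0"
    if "\<theta> \<in> K'" for \<theta>
  proof -
    have s: "0 < snd \<theta>" using that K(2) by (auto simp: K'_def)
    have "\<theta> \<noteq> \<theta>\<^sub>0" using that e by (auto simp: K'_def)
    then have "\<mu> \<theta> < \<mu> \<theta>\<^sub>0" unfolding \<mu>_def \<theta>\<^sub>0_def by (rule expectation_logdens_less[OF s])
    \<comment> \<open>The intermediate level \<open>c\<close> separates the averages: near
      \<open>\<theta>\<close> they eventually stay below it, at \<open>\<theta>\<^sub>0\<close>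
      above it.\<close>
    then obtain c where c: "\<mu> \<theta> < c" "c < \<mu> \<theta>\<^sub>0" using dense by blast
    show ?thesis
      using local_domination[OF s c(1)[unfolded \<mu>_def]] c(2) by metis
  qed
  then obtain \<rho> c where \<rho>c: "\<And>\<theta>. \<theta> \<in> K' \<Longrightarrow> 0 < \<rho> \<theta> \<and> \<rho> \<theta> \<le> snd \<theta> / 2 \<and>
      (\<integral>z. local_sup \<theta> (\<rho> \<theta>) z \<partial>Q) < c \<theta> \<and> c \<theta> < \<mu> \<theta>\<^sub>0" by metis
  have K'_pos: "0 < snd \<theta>" if "\<theta> \<in> K'" for \<theta> using that K(2) by (auto simp: K'_def)
  have "K' \<subseteq> (\<Union>\<theta>\<in>K'. ball \<theta> (\<rho> \<theta>))" using \<rho>c by force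
  then obtain T where T: "T \<subseteq> K'" "finite T" "K' \<subseteq> (\<Union>\<theta>\<in>T. ball \<theta> (\<rho> \<theta>))"
    by (rule compactE_image[OF \<open>compact K'\<close> open_ball])
  have "whp M (\<lambda>n \<omega>. (\<Sum>i<n. local_sup t (\<rho> t) (Z i \<omega>)) < n * c t \<and> n * c t < S n \<omega> \<theta>\<^sub>0)"
    if "t \<in> T" for t
  proof (rule whp_conj)
    have t: "t \<in> K'" using that T(1) by blast
    show "whp M (\<lambda>n \<omega>. (\<Sum>i<n. local_sup t (\<rho> t) (Z i \<omega>)) < n * c t)"
      using \<rho>c[OF t] K'_pos[OF t] by (intro lln_less local_sup_sq_integrable) auto
    show "whp M (\<lambda>n \<omega>. n * c t < S n \<omega> \<theta>\<^sub>0)" using \<rho>c[OF t] by (intro lln_greater) auto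
  qed
  then have "whp M (\<lambda>n \<omega>. \<forall>t\<in>T. (\<Sum>i<n. local_sup t (\<rho> t) (Z i \<omega>)) < n * c t \<and> n * c t < S n \<omega> \<theta>\<^sub>0)"
    by (rule whp_ball[OF T(2)])
  moreover have "whp M (\<lambda>n \<omega>. n * L < S n \<omega> \<theta>\<^sub>0)"
    by (rule lln_greater) (simp add: L_def)
  ultimately have "whp M (\<lambda>n \<omega>. (\<forall>v. n / 2 \<le>
      (\<Sum>i<n. indicator {z. \<delta> * norm v \<le> \<bar>v \<bullet> z\<bar>} (Z i \<omega>) :: real)) \<and> n * L < S n \<omega> \<theta>\<^sub>0 \<and>
      (\<forall>t\<in>T. (\<Sum>i<n. local_sup t (\<rho> t) (Z i \<omega>)) < n * c t \<and> n * c t < S n \<omega> \<theta>\<^sub>0))"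
    by (intro whp_conj half)
  then show ?thesis
  proof (rule whp_mono, intro always_eventually allI ballI impI, elim conjE)
    fix n \<omega>
    assume halfn: "\<forall>v. n / 2 \<le> (\<Sum>i<n. indicator {z. \<delta> * norm v \<le> \<bar>v \<bullet> z\<bar>} (Z i \<omega>) :: real)"
      and Ln: "n * L < S n \<omega> \<theta>\<^sub>0"
      and Tn: "\<forall>t\<in>T. (\<Sum>i<n. local_sup t (\<rho> t) (Z i \<omega>)) < n * c t \<and> n * c t < S n \<omega> \<theta>\<^sub>0"
    \<comment> \<open>Inside \<open>K\<close> a member of the finite cover gives the strict loss,
      outside \<open>K\<close> coercivity does.\<close>
    have far: "S n \<omega> \<theta> < S n \<omega> \<theta>\<^sub>0" if s: "0 < snd \<theta>" and d: "e \<le> dist \<theta> \<theta>\<^sub>0" for \<theta>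
    proof (cases "\<theta> \<in> K")
      case True
      then have "\<theta> \<in> K'" using d by (simp add: K'_def dist_commute)
      then obtain t where t: "t \<in> T" "dist t \<theta> < \<rho> t" using T(3) by auto
      then have t': "t \<in> K'" using T(1) by blast
      have "S n \<omega> \<theta> \<le> (\<Sum>i<n. local_sup t (\<rho> t) (Z i \<omega>))"
        unfolding S_def using \<rho>c[OF t'] K'_pos[OF t'] t(2)
        by (intro sum_mono logdens_le_local_sup) (auto simp: dist_commute)
      then show ?thesis using Tn t(1) by force
    next
      case False
      obtain \<beta> s where \<theta>: "\<theta> = (\<beta>, s)" by (cases \<theta>)
      have "S n \<omega> \<theta> \<le> n * (ln C - ln s - (\<delta> * norm (- \<beta>, 1 :: real) / s) powr \<alpha> / 2)"
        unfolding S_def \<theta> using s halfn by (intro sum_logdens_le \<delta>) (auto simp: \<theta>)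
      also have "\<dots> \<le> n * L"
        using coercive[of s \<beta>] s False by (intro mult_left_mono) (auto simp: \<theta>)
      finally show ?thesis using Ln by simp
    qed
    \<comment> \<open>Here \<open>e < s\<^sub>0\<close> keeps the scale positive on the closed
      ball.\<close>
    have cb: "cball \<theta>\<^sub>0 e \<subseteq> UNIV \<times> {0<..}"
    proof
      fix \<theta> assume "\<theta> \<in> cball \<theta>\<^sub>0 e"
      then have "\<bar>snd \<theta> - s\<^sub>0\<bar> \<le> e"
        using dist_snd_le[of \<theta> \<theta>\<^sub>0] by (simp add: \<theta>\<^sub>0_def dist_commute dist_real_def)
      then have "0 < snd \<theta>" using e by linarith
      then show "\<theta> \<in> UNIV \<times> {0<..}" by (cases \<theta>) auto
    qed
    \<comment> \<open>A maximizer over the closed ball is global, since parameters outside lose to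
      its centre.\<close>
    have "continuous_on (cball \<theta>\<^sub>0 e) (S n \<omega>)"
      unfolding S_def by (intro continuous_on_sum continuous_on_subset[OF continuous_on_logdens cb])
    then obtain \<theta>s where \<theta>s: "\<theta>s \<in> cball \<theta>\<^sub>0 e" "\<And>\<theta>. \<theta> \<in> cball \<theta>\<^sub>0 e \<Longrightarrow> S n \<omega> \<theta> \<le> S n \<omega> \<theta>s"
      using continuous_attains_sup[of "cball \<theta>\<^sub>0 e" "S n \<omega>"] e by auto
    have "0 < snd \<theta>s" using cb \<theta>s(1) by force
    moreover have "S n \<omega> \<theta> \<le> S n \<omega> \<theta>s" if "0 < snd \<theta>" for \<theta>
    proof (cases "e \<le> dist \<theta> \<theta>\<^sub>0")
      case True
      then have "S n \<omega> \<theta> < S n \<omega> \<theta>\<^sub>0" using far that by blast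
      also have "\<dots> \<le> S n \<omega> \<theta>s" using \<theta>s(2)[of \<theta>\<^sub>0] e by simp
      finally show ?thesis by simp
    qed (use \<theta>s(2) in \<open>simp add: dist_commute\<close>)
    moreover have "dist \<theta> \<theta>\<^sub>0 < e" if "0 < snd \<theta>" "\<forall>\<theta>'. 0 < snd \<theta>' \<longrightarrow> S n \<omega> \<theta>' \<le> S n \<omega> \<theta>" for \<theta>
      using far[of \<theta>] that pos0 by (meson not_le)
    ultimately show "(\<exists>\<theta>. 0 < snd \<theta> \<and> (\<forall>\<theta>'. 0 < snd \<theta>' \<longrightarrow> S n \<omega> \<theta>' \<le> S n \<omega> \<theta>)) \<and>
      (\<forall>\<theta>. 0 < snd \<theta> \<longrightarrow> (\<forall>\<theta>'. 0 < snd \<theta>' \<longrightarrow> S n \<omega> \<theta>' \<le> S n \<omega> \<theta>) \<longrightarrow> dist \<theta> (\<beta>\<^sub>0, s\<^sub>0) < e)"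
      unfolding \<theta>\<^sub>0_def[symmetric] by blast
  qed
qed

end

section \<open>Transfer to maximum likelihood estimators\<close>

lemma (in positive_unimodal_density) loglik_eq_sum_logdens:
  "loglik f n x y \<beta> s = ereal (\<Sum>i<n. logdens f (\<beta>, s) (x i, y i))"
  unfolding loglik_def logdens_def log0_def
  using pos by (simp add: sum_subtractf)

lemma (in positive_unimodal_density) is_mle_iff:
  "is_mle f n x y b t \<longleftrightarrow> 0 < t \<and> (\<forall>\<theta>. 0 < snd \<theta> \<longrightarrow>
     (\<Sum>i<n. logdens f \<theta> (x i, y i)) \<le> (\<Sum>i<n. logdens f (b, t) (x i, y i)))"
  unfolding is_mle_def loglik_eq_sum_logdens by simp

theorem theorem2:
  fixes P :: "'p measure" and M :: "'w measure"
    and X :: "'p \<Rightarrow> real ^ 'd" and \<epsilon> Y :: "'p \<Rightarrow> real"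
    and Xs :: "nat \<Rightarrow> 'w \<Rightarrow> real ^ 'd" and Ys :: "nat \<Rightarrow> 'w \<Rightarrow> real"
    and \<beta>\<^sub>0 :: "real ^ 'd" and s\<^sub>0 \<alpha> C :: real
    and f :: "real \<Rightarrow> real" and fX :: "real ^ 'd \<Rightarrow> ennreal"
    and bhat :: "nat \<Rightarrow> 'w \<Rightarrow> real ^ 'd" and shat :: "nat \<Rightarrow> 'w \<Rightarrow> real"
  assumes "prob_space P" and "prob_space M"
    and s0: "0 < s\<^sub>0"
    and model: "\<And>\<omega>. \<omega> \<in> space P \<Longrightarrow> Y \<omega> = \<beta>\<^sub>0 \<bullet> X \<omega> + \<epsilon> \<omega>"
    and iid_indep: "prob_space.indep_vars M (\<lambda>_. borel) (\<lambda>i \<omega>. (Xs i \<omega>, Ys i \<omega>)) UNIV"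
    and iid_law: "\<And>i. distr M borel (\<lambda>\<omega>. (Xs i \<omega>, Ys i \<omega>)) = distr P borel (\<lambda>\<omega>. (X \<omega>, Y \<omega>))"
    and A1: "prob_space.indep_set P
        {X -` A \<inter> space P |A. A \<in> sets borel} {\<epsilon> -` B \<inter> space P |B. B \<in> sets borel}"
    and A2: "distributed P lborel X fX"
    and A3_density: "distributed P lborel \<epsilon> (\<lambda>t. ennreal (f (t / s\<^sub>0) / s\<^sub>0))"
    and A3_prob: "\<And>t. 0 \<le> f t" "(\<integral>\<^sup>+t. ennreal (f t) \<partial>lborel) = 1"
    and A3_even: "\<And>t. f (- t) = f t"
    and A3_bounded: "bounded (range f)"
    and A3_continuous: "continuous_on UNIV f"
    and A3_moment: "integrable lborel (\<lambda>t. t\<^sup>2 * f t)"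
    and A4: "0 < \<alpha>" "0 < C" "\<And>t. f t \<le> C * exp (- (\<bar>t\<bar> powr \<alpha>))"
    and A5: "(\<integral>\<^sup>+\<omega>. e2ennreal \<bar>log0 (f ((Y \<omega> - \<beta>\<^sub>0 \<bullet> X \<omega>) / s\<^sub>0))\<bar> \<partial>P) < \<infinity>"
    and A6: "integrable P (\<lambda>\<omega>. norm (X \<omega>) powr max (2 * \<alpha>) 2)"
    and A7: "antimono_on {0..} f"
    and A8: "\<And>R a. 0 < R \<Longrightarrow> 0 < a \<Longrightarrow>
        (\<integral>\<^sup>+\<omega>. e2ennreal ((log0 (f ((\<bar>Y \<omega>\<bar> + R * norm (X \<omega>)) / a)))\<^sup>2) \<partial>P) < \<infinity>"
    and mle: "\<forall>\<^sub>F n in sequentially. AE \<omega> in M.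
        (\<exists>b t. is_mle f n (\<lambda>i. Xs i \<omega>) (\<lambda>i. Ys i \<omega>) b t) \<longrightarrow>
        is_mle f n (\<lambda>i. Xs i \<omega>) (\<lambda>i. Ys i \<omega>) (bhat n \<omega>) (shat n \<omega>)"
  shows "converges_in_prob M (\<lambda>n \<omega>. (bhat n \<omega>, shat n \<omega>)) (\<beta>\<^sub>0, s\<^sub>0)"
proof -
  interpret P: prob_space P by fact
  have X[measurable]: "X \<in> borel_measurable P"
    using distributed_measurable[OF A2] by simp
  have eps[measurable]: "\<epsilon> \<in> borel_measurable P"
    using distributed_measurable[OF A3_density] by simp
  have Y[measurable]: "Y \<in> borel_measurable P"
    by (subst measurable_cong[OF model]) auto
  have f_meas[measurable]: "f \<in> borel_measurable borel"
    using A3_continuous by (rule borel_measurable_continuous_onI)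
  have [measurable]: "log0 \<in> borel_measurable borel"
    unfolding log0_def by measurable
  have [measurable]: "(\<lambda>x :: ereal. x\<^sup>2) \<in> borel_measurable borel"
    unfolding power2_eq_square by measurable
  have distr_X: "distr P borel X = density lborel fX"
    using distributed_distr_eq_density[OF A2] by (simp cong: distr_cong)
  have hyperplane: "AE \<omega> in P. b \<bullet> X \<omega> \<noteq> 0" if "b \<noteq> 0" for b
  proof -
    have "{x. b \<bullet> x = 0} \<in> null_sets lebesgue"
      using negligible_hyperplane[of b 0] that by (simp add: negligible_iff_null_sets)
    then have "{x. b \<bullet> x = 0} \<in> null_sets lborel"
      by (subst (asm) null_sets_completion_iff) auto
    then have "AE x in lborel. b \<bullet> x \<noteq> 0"
      using AE_not_in by fastforce
    then have "AE x in density lborel fX. b \<bullet> x \<noteq> 0"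
      using distributed_borel_measurable[OF A2] by (subst AE_density) auto
    then show ?thesis
      unfolding distr_X[symmetric] by (subst (asm) AE_distr_iff) auto
  qed

  \<comment> \<open>(A8) forces \<open>f > 0\<close> almost surely at \<open>(\<bar>Y\<bar> + \<parallel>X\<parallel>) / a\<close>, and for small \<open>a\<close> this point
    exceeds any given \<open>u\<close>; monotonicity does the rest. From here on \<open>log 0\<close> never occurs.\<close>
  have f_pos: "0 < f u" for u
  proof -
    have "AE \<omega> in P. 0 < f ((\<bar>Y \<omega>\<bar> + 1 * norm (X \<omega>)) / (1 / real (Suc k)))" for k
    proof -
      have "AE \<omega> in P. e2ennreal ((log0 (f ((\<bar>Y \<omega>\<bar> + 1 * norm (X \<omega>)) / (1 / real (Suc k)))))\<^sup>2) \<noteq> \<infinity>"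
        using A8[of 1 "1 / real (Suc k)"] by (intro nn_integral_PInf_AE) auto
      then show ?thesis
        by eventually_elim (auto simp: log0_def power2_eq_square split: if_splits)
    qed
    then have "AE \<omega> in P. \<forall>k. 0 < f ((\<bar>Y \<omega>\<bar> + 1 * norm (X \<omega>)) / (1 / real (Suc k)))"
      by (intro AE_all_countable[THEN iffD2] allI)
    moreover have "AE \<omega> in P. X \<omega> \<noteq> 0"
    proof -
      \<comment> \<open>A single nonzero \<open>b\<close> with
        \<open>b \<bullet> X \<omega> \<noteq> 0\<close> already forces \<open>X \<omega>\<close> to
        be nonzero; any coordinate vector serves.\<close>
      have "axis undefined 1 \<noteq> (0 :: real ^ 'd)" by (simp add: axis_eq_0_iff)
      from hyperplane[OF this] show ?thesis by eventually_elim auto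
    qed
    ultimately have AE: "AE \<omega> in P. X \<omega> \<noteq> 0 \<and> (\<forall>k. 0 < f ((\<bar>Y \<omega>\<bar> + 1 * norm (X \<omega>)) / (1 / real (Suc k))))"
      by (rule AE_conjI[rotated])
    have "\<exists>\<omega>. X \<omega> \<noteq> 0 \<and> (\<forall>k. 0 < f ((\<bar>Y \<omega>\<bar> + 1 * norm (X \<omega>)) / (1 / real (Suc k))))"
    proof (rule ccontr)
      assume none: "\<nexists>\<omega>. X \<omega> \<noteq> 0 \<and> (\<forall>k. 0 < f ((\<bar>Y \<omega>\<bar> + 1 * norm (X \<omega>)) / (1 / real (Suc k))))"
      from AE have "AE \<omega> in P. False" by (rule eventually_mono) (use none in blast)
      then show False by simp
    qed
    then obtain \<omega> where \<omega>: "X \<omega> \<noteq> 0" "\<And>k. 0 < f ((\<bar>Y \<omega>\<bar> + 1 * norm (X \<omega>)) / (1 / real (Suc k)))"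
      by blast
    define r where "r = \<bar>Y \<omega>\<bar> + norm (X \<omega>)"
    have "0 < r" using \<omega>(1) by (simp add: r_def add_nonneg_pos)
    obtain k :: nat where k: "\<bar>u\<bar> / r \<le> k" using real_arch_simple by blast
    then have "\<bar>u\<bar> \<le> r * real (Suc k)"
      using \<open>0 < r\<close> by (simp add: field_simps)
    then have "f (r * real (Suc k)) \<le> f \<bar>u\<bar>"
      using \<open>0 < r\<close> by (intro monotone_onD[OF A7]) auto
    moreover have "f \<bar>u\<bar> = f u" by (simp add: abs_if A3_even)
    ultimately show ?thesis using \<omega>(2)[of k] by (simp add: r_def)
  qed

  define D where "D = distr P borel X"
  define Q where "Q = distr P borel (\<lambda>\<omega>. (X \<omega>, Y \<omega>))"
  have XY[measurable]: "(\<lambda>\<omega>. (X \<omega>, Y \<omega>)) \<in> borel_measurable P"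
    unfolding borel_prod[symmetric] by measurable

  have distr_eps: "distr P borel \<epsilon> = density lborel (\<lambda>t. ennreal (f (t / s\<^sub>0) / s\<^sub>0))"
    using distributed_distr_eq_density[OF A3_density] by (simp cong: distr_cong)
  \<comment> \<open>Product measures are determined by rectangles, where (A1) gives the product
    formula.\<close>
  have joint: "D \<Otimes>\<^sub>M density lborel (\<lambda>t. ennreal (f (t / s\<^sub>0) / s\<^sub>0)) =
      distr P (borel \<Otimes>\<^sub>M borel) (\<lambda>\<omega>. (X \<omega>, \<epsilon> \<omega>))"
  proof (rule pair_measure_eqI)
    have "prob_space (distr P borel \<epsilon>)" by (rule P.prob_space_distr) simp
    then show "sigma_finite_measure (density lborel (\<lambda>t. ennreal (f (t / s\<^sub>0) / s\<^sub>0)))"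
      unfolding distr_eps by (rule prob_space_imp_sigma_finite)
    have "prob_space D" unfolding D_def by (rule P.prob_space_distr) simp
    then show "sigma_finite_measure D" by (rule prob_space_imp_sigma_finite)
    show "sets (D \<Otimes>\<^sub>M density lborel (\<lambda>t. ennreal (f (t / s\<^sub>0) / s\<^sub>0))) =
        sets (distr P (borel \<Otimes>\<^sub>M borel) (\<lambda>\<omega>. (X \<omega>, \<epsilon> \<omega>)))"
      unfolding sets_distr by (intro sets_pair_measure_cong) (simp_all add: D_def)
    fix A B
    assume "A \<in> sets D" "B \<in> sets (density lborel (\<lambda>t. ennreal (f (t / s\<^sub>0) / s\<^sub>0)))"
    then have [measurable]: "A \<in> sets borel" "B \<in> sets borel" by (simp_all add: D_def)
    have "P.prob ((X -` A \<inter> space P) \<inter> (\<epsilon> -` B \<inter> space P)) =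
        P.prob (X -` A \<inter> space P) * P.prob (\<epsilon> -` B \<inter> space P)"
      by (rule P.indep_setD[OF A1]) auto
    moreover have "(\<lambda>\<omega>. (X \<omega>, \<epsilon> \<omega>)) -` (A \<times> B) \<inter> space P =
        (X -` A \<inter> space P) \<inter> (\<epsilon> -` B \<inter> space P)" by auto
    ultimately show "emeasure D A * emeasure (density lborel (\<lambda>t. ennreal (f (t / s\<^sub>0) / s\<^sub>0))) B =
        emeasure (distr P (borel \<Otimes>\<^sub>M borel) (\<lambda>\<omega>. (X \<omega>, \<epsilon> \<omega>))) (A \<times> B)"
      unfolding D_def distr_eps[symmetric]
      by (simp add: emeasure_distr P.emeasure_eq_measure flip: ennreal_mult'')
  qed

  interpret regression_law f \<alpha> C D \<beta>\<^sub>0 s\<^sub>0 Q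
  proof (intro regression_law.intro regression_law_axioms.intro positive_unimodal_density.intro)
    show "prob_space D" unfolding D_def by (rule P.prob_space_distr) simp
    show "sets D = sets borel" by (simp add: D_def)
    show "measure D {x. b \<bullet> x = 0} = 0" if "b \<noteq> 0" for b
    proof -
      have "measure D {x. b \<bullet> x = 0} = P.prob (X -` {x. b \<bullet> x = 0} \<inter> space P)"
        unfolding D_def by (rule measure_distr) auto
      also have "\<dots> = 0"
        using hyperplane[OF that] by (subst P.prob_eq_0) auto
      finally show ?thesis .
    qed
    show "Q = distr (D \<Otimes>\<^sub>M density lborel (\<lambda>t. ennreal (f (t / s\<^sub>0) / s\<^sub>0))) borel
        (\<lambda>(x, t). (x, \<beta>\<^sub>0 \<bullet> x + t))"
    proof -
      have [measurable]: "(\<lambda>(x, t). (x, \<beta>\<^sub>0 \<bullet> x + t)) \<in> measurable (borel \<Otimes>\<^sub>M borel) (borel :: ((real ^ 'd) \<times> real) measure)"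
        unfolding borel_prod[symmetric] by measurable
      show ?thesis
        unfolding joint Q_def by (subst distr_distr) (auto intro!: distr_cong simp: model)
    qed
    show "integrable Q (\<lambda>z. (ln (f ((\<bar>snd z\<bar> + R * norm (fst z)) / a)))\<^sup>2)" if "0 < R" "0 < a" for R a
    proof -
      have [measurable]: "(\<lambda>z. (ln (f ((\<bar>snd z\<bar> + R * norm (fst z)) / a)))\<^sup>2) \<in>
          borel_measurable (borel :: ((real ^ 'd) \<times> real) measure)"
        unfolding borel_prod[symmetric] by measurable
      \<comment> \<open>With \<open>f\<close> positive, \<open>log0\<close> is the real logarithm,
        so the extended-real bound (A8) becomes square integrability.\<close>
      have "integrable P (\<lambda>\<omega>. (ln (f ((\<bar>Y \<omega>\<bar> + R * norm (X \<omega>)) / a)))\<^sup>2)"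
        using A8[OF that] f_pos by (intro integrableI_nonneg) (auto simp: log0_def power2_eq_square)
      then show ?thesis
        unfolding Q_def by (subst integrable_distr_eq) auto
    qed
  qed (use f_pos A3_even A7 A3_continuous A3_prob A4 s0 in auto)

  show ?thesis
    unfolding converges_in_prob_def
  proof (intro allI impI)
    fix e :: real assume "0 < e"
    \<comment> \<open>Shrinking the radius below \<open>s\<^sub>0\<close> meets the requirement of
      \<open>consistency\<close>; closeness within \<open>e'\<close> implies closeness within
      \<open>e\<close>.\<close>
    define e' where "e' = min e (s\<^sub>0 / 2)"
    have e': "0 < e'" "e' < s\<^sub>0" using \<open>0 < e\<close> s0 by (auto simp: e'_def)
    have "whp M (\<lambda>n \<omega>. dist (bhat n \<omega>, shat n \<omega>) (\<beta>\<^sub>0, s\<^sub>0) \<le> e)"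
    proof (rule whp_mono[OF whp_conj[OF whp_AE[OF mle]
          consistency[OF \<open>prob_space M\<close> iid_indep iid_law[folded Q_def] e']]],
          intro always_eventually allI ballI impI, elim conjE exE)
      fix n \<omega> \<theta>
      let ?S = "\<lambda>\<theta>. \<Sum>i<n. logdens f \<theta> (Xs i \<omega>, Ys i \<omega>)"
      assume mle_n: "(\<exists>b t. is_mle f n (\<lambda>i. Xs i \<omega>) (\<lambda>i. Ys i \<omega>) b t) \<longrightarrow>
          is_mle f n (\<lambda>i. Xs i \<omega>) (\<lambda>i. Ys i \<omega>) (bhat n \<omega>) (shat n \<omega>)"
        and max: "0 < snd \<theta>" "\<forall>\<theta>'. 0 < snd \<theta>' \<longrightarrow> ?S \<theta>' \<le> ?S \<theta>"
        and near: "\<forall>\<theta>. 0 < snd \<theta> \<longrightarrow> (\<forall>\<theta>'. 0 < snd \<theta>' \<longrightarrow> ?S \<theta>' \<le> ?S \<theta>) \<longrightarrow> dist \<theta> (\<beta>\<^sub>0, s\<^sub>0) < e'"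
      \<comment> \<open>The maximizer from \<open>consistency\<close> triggers the conditional
        hypothesis on the estimator, which is then itself a maximizer and hence close.\<close>
      have "is_mle f n (\<lambda>i. Xs i \<omega>) (\<lambda>i. Ys i \<omega>) (fst \<theta>) (snd \<theta>)"
        using max by (simp add: is_mle_iff)
      then have "is_mle f n (\<lambda>i. Xs i \<omega>) (\<lambda>i. Ys i \<omega>) (bhat n \<omega>) (shat n \<omega>)"
        using mle_n by blast
      then have "dist (bhat n \<omega>, shat n \<omega>) (\<beta>\<^sub>0, s\<^sub>0) < e'"
        by (intro near[rule_format]) (auto simp: is_mle_iff)
      then show "dist (bhat n \<omega>, shat n \<omega>) (\<beta>\<^sub>0, s\<^sub>0) \<le> e" by (simp add: e'_def)
    qed
    then show "(\<lambda>n. outer_measure_of M {\<omega> \<in> space M. e < dist (bhat n \<omega>, shat n \<omega>) (\<beta>\<^sub>0, s\<^sub>0)}) \<longlonglongrightarrow> 0"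
      by (simp add: whp_def not_le)
  qed
qed

end
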